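(* Let $k$ be a field of characteristic $0$ and $X=\{X_1,\dots,X_g\}$. Let $\mathcal I\subset k\langle X\rangle$ be a grr ideal with rational resolvent $r=(r_1,\dots,r_{g''})$. Assume there is a tuple $P$ of $m\times m$ matrices with $P\in\operatorname{dom} r$, and that the rational functions $r_j$ can be defined by rational expressions with realizations about $P$ of dimensions at most $n$. If $f\in k\langle X\rangle$ is of degree $u\ge1$, has $v$ terms, and vanishes on $Z(\mathcal I)\cap M_N(k)^g$, where $$N=m\Big\lceil\frac{m\,u\,v\,\max(n,2)}{2}\Big\rceil,$$ then $f$ vanishes on $Z(\mathcal I)$.
   Context: $k\langle X\rangle$ is the free associative unital algebra over $k$ in the freely noncommuting variables $X_1,\dots,X_g$; "ideal" means two-sided ideal; the number of terms of $f$ is the number of words with nonzero coefficient in $f$. For an ideal $\mathcal I\subset k\langle X\rangle$ put $Z(\mathcal I)=\bigcup_{n\in\mathbb N}\{A\in M_n(k)^g : h(A)=0\ \text{for all } h\in\mathcal I\}$. Rational functions. An nc rational expression in $X$ is a formal expression built from elements of $k\langle X\rangle$ using addition, multiplication and inversion; its domain is the set of all $g$-tuples of square matrices over $k$ (of all sizes) at which all inverses occurring in it exist. Only expressions with nonempty domain are considered. Two expressions are equivalent if they agree on the intersection of their domains; equivalence classes are (nc) rational functions and form the free skew field $k(\!\langle X\rangle\!)$. The domain of a rational function consists of the tuples at which some expression representing it is defined. Geometric rational resolvability. Fix a partition $X=X'\cup X''=\{X'_1,\dots,X'_{g'}\}\cup\{X''_1,\dots,X''_{g''}\}$ and a tuple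 $r=(r_1,\dots,r_{g''})$ with $r_j\in k(\!\langle X'\rangle\!)$. Let $\operatorname{dom} r\subset\bigcup_nM_n(k)^{g'}$ be the common domain of the $r_j$ and $\Gamma(r)=\{(A,r(A)): A\in\operatorname{dom} r\}\subset\bigcup_nM_n(k)^g$. The ideal $\mathcal I$ is geometrically rationally resolvable (grr) with rational resolvent $r$ if $\Gamma(r)\subseteq Z(\mathcal I)$ and every polynomial in $k\langle X\rangle$ that vanishes on $\Gamma(r)$ also vanishes on $Z(\mathcal I)$. Realizations (for expressions in $X'$, about $P\in M_m(k)^{g'}$). Let $\mathcal A=M_m(k)$ and let $Y=\{Y_1,\dots,Y_{g'}\}$ be freely noncommuting letters; $\langle Y\rangle$ is the free monoid on $Y$ and $|w|$ the length of a word $w=w_1\cdots w_{|w|}$. The algebra of generalized polynomials is the free product $\mathcal A\langle Y\rangle=M_m(k)*_kk\langle Y\rangle$, and the algebra of generalized series $\mathcal A\langle\!\langle Y\rangle\!\rangle$ is its completion with respect to the $(Y)$-adic topology. Let $\mathcal A^{Y_i}=\sum\mathcal AY_i\mathcal A$ be the $\mathcal A$-bimodule generated by $Y_i$, and $\mathcal A^w=\mathcal A^{w_1}\cdots\mathcal A^{w_{|w|}}$ (with $\mathcal A^1=\mathcal A$). For a series $S$ let $[S,w]\in\mathcal A^w$ denote its component on the word $w$. A linear representation of dimension $n$ is a triple $(c,A,b)$ with $c\in\mathcal A^{1\times n}$, $b\in\mathcal A^{n\times1}$ and matrices $A^{Y_i}\in(\mathcal A^{Y_i})^{n\times n}$;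 write $A^w=A^{w_1}\cdots A^{w_{|w|}}$. It represents $S$ if $[S,w]=cA^wb$ for all $w\in\langle Y\rangle$. If a rational expression $s$ is defined at $P$, then $s(Y+P)$ is an element of $\mathcal A\langle\!\langle Y\rangle\!\rangle$ (a generalized series is invertible iff its constant term is invertible in $\mathcal A$), and a realization of $s$ about $P$ is a linear representation of the series $s(Y+P)$. *)

theory Defs
  imports
    "HOL-Library.Poly_Mapping"
    "HOL-Algebra.Ideal"
    "Jordan_Normal_Form.Gauss_Jordan_Elimination"
    "Jordan_Normal_Form.VS_Connect"
begin

section \<open>The free algebra\<close>

text \<open>
  A copy of the type of lists, made into a monoid under concatenation, so that the
  (convolution) product of \<^theory>\<open>HOL-Library.Poly_Mapping\<close> is the product of the free
  algebra on the letters \<open>'x\<close>. The monoid is written additively because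
  \<^theory>\<open>HOL-Library.Poly_Mapping\<close> requires it.
\<close>

datatype 'x nc_word = Word (letters: "'x list")

instantiation nc_word :: (type) monoid_add
begin

definition "0 = Word []"

definition "u + v = Word (letters u @ letters v)"

instance
  by standard (simp_all add: zero_nc_word_def plus_nc_word_def)

end

type_synonym ('x, 'k) nc_poly = "'x nc_word \<Rightarrow>\<^sub>0 'k"

definition nc_polys_over :: "'x set \<Rightarrow> ('x, 'k::zero) nc_poly set" where
  "nc_polys_over V = {f. \<forall>w \<in> Poly_Mapping.keys f. set (letters w) \<subseteq> V}"

definition nc_degree :: "('x, 'k::zero) nc_poly \<Rightarrow> nat" where
  "nc_degree f = Max (insert 0 ((\<lambda>w. length (letters w)) ` Poly_Mapping.keys f))"

definition nc_num_terms :: "('x, 'k::zero) nc_poly \<Rightarrow> nat" where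
  "nc_num_terms f = card (Poly_Mapping.keys f)"


section \<open>Evaluation at tuples of matrices\<close>

text \<open>
  A point is a pair \<open>(n, A)\<close> of a size \<open>n \<ge> 1\<close> and a tuple \<open>A\<close> of \<open>n \<times> n\<close> matrices indexed
  by \<open>V\<close>. Recording the size keeps the points of different sizes apart even if \<open>V = {}\<close>.
\<close>

type_synonym ('x, 'k) point = "nat \<times> ('x \<Rightarrow> 'k mat)"

definition points_of_size :: "nat \<Rightarrow> 'x set \<Rightarrow> ('x, 'k) point set" where
  "points_of_size n V = {n} \<times> (V \<rightarrow>\<^sub>E carrier_mat n n)"

definition points :: "'x set \<Rightarrow> ('x, 'k) point set" where
  "points V = (\<Union>n\<in>{1..}. points_of_size n V)"

definition word_eval :: "nat \<Rightarrow> ('x \<Rightarrow> 'k::semiring_1 mat) \<Rightarrow> 'x list \<Rightarrow> 'k mat" where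
  "word_eval n A w = foldr (\<lambda>x M. A x * M) w (1\<^sub>m n)"

definition nc_eval :: "('x, 'k::semiring_1) point \<Rightarrow> ('x, 'k) nc_poly \<Rightarrow> 'k mat" where
  "nc_eval = (\<lambda>(n, A) f. mat n n (\<lambda>ij. \<Sum>w\<in>Poly_Mapping.keys f.
      Poly_Mapping.lookup f w * word_eval n A (letters w) $$ ij))"

definition vanishes_on :: "('x, 'k::semiring_1) nc_poly \<Rightarrow> ('x, 'k) point set \<Rightarrow> bool" where
  "vanishes_on f S \<longleftrightarrow> (\<forall>(n, A)\<in>S. nc_eval (n, A) f = 0\<^sub>m n n)"

definition zero_locus :: "('x, 'k::semiring_1) nc_poly set \<Rightarrow> ('x, 'k) point set" where
  "zero_locus I = {(n, A) \<in> points UNIV. \<forall>h\<in>I. nc_eval (n, A) h = 0\<^sub>m n n}"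


section \<open>Rational expressions and rational functions\<close>

datatype (polys: 'p) rat_expr =
    Pol 'p
  | Add "'p rat_expr" "'p rat_expr"
  | Mul "'p rat_expr" "'p rat_expr"
  | Inv "'p rat_expr"

type_synonym ('x, 'k) nc_rat_expr = "('x, 'k) nc_poly rat_expr"

text \<open>\<^term>\<open>None\<close> means that one of the inverses occurring in the expression does not exist.\<close>

primrec rat_eval :: "('x, 'k::field) point \<Rightarrow> ('x, 'k) nc_rat_expr \<Rightarrow> 'k mat option" where
  "rat_eval p (Pol f) = Some (nc_eval p f)"
| "rat_eval p (Add s t) =
     Option.bind (rat_eval p s) (\<lambda>M. Option.bind (rat_eval p t) (\<lambda>N. Some (M + N)))"
| "rat_eval p (Mul s t) =
     Option.bind (rat_eval p s) (\<lambda>M. Option.bind (rat_eval p t) (\<lambda>N. Some (M * N)))"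
| "rat_eval p (Inv s) = Option.bind (rat_eval p s) mat_inverse"

definition expr_dom :: "'x set \<Rightarrow> ('x, 'k::field) nc_rat_expr \<Rightarrow> ('x, 'k) point set" where
  "expr_dom V s = {p \<in> points V. rat_eval p s \<noteq> None}"

definition rat_exprs :: "'x set \<Rightarrow> ('x, 'k::field) nc_rat_expr set" where
  "rat_exprs V = {s. polys s \<subseteq> nc_polys_over V \<and> expr_dom V s \<noteq> {}}"

definition rat_equiv :: "'x set \<Rightarrow> (('x, 'k::field) nc_rat_expr \<times> ('x, 'k) nc_rat_expr) set" where
  "rat_equiv V = {(s, t). s \<in> rat_exprs V \<and> t \<in> rat_exprs V \<and>
     (\<forall>p \<in> expr_dom V s \<inter> expr_dom V t. rat_eval p s = rat_eval p t)}"

definition free_skew_field :: "'x set \<Rightarrow> ('x, 'k::field) nc_rat_expr set set" where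
  "free_skew_field V = rat_exprs V // rat_equiv V"

definition rat_fun_dom :: "'x set \<Rightarrow> ('x, 'k::field) nc_rat_expr set \<Rightarrow> ('x, 'k) point set" where
  "rat_fun_dom V q = (\<Union>s\<in>q. expr_dom V s)"

definition rat_fun_eval :: "('x, 'k::field) point \<Rightarrow> ('x, 'k) nc_rat_expr set \<Rightarrow> 'k mat" where
  "rat_fun_eval p q = the (rat_eval p (SOME s. s \<in> q \<and> rat_eval p s \<noteq> None))"


section \<open>Geometric rational resolvability\<close>

text \<open>
  The letters are partitioned into \<open>V\<close> and its complement; a resolvent is a tuple of
  rational functions in the letters \<open>V\<close>, indexed by \<open>- V\<close>.
\<close>

definition resolvent_dom ::
    "'x set \<Rightarrow> ('x \<Rightarrow> ('x, 'k::field) nc_rat_expr set) \<Rightarrow> ('x, 'k) point set" where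
  "resolvent_dom V r = {p \<in> points V. \<forall>j\<in>- V. p \<in> rat_fun_dom V (r j)}"

definition resolvent_graph ::
    "'x set \<Rightarrow> ('x \<Rightarrow> ('x, 'k::field) nc_rat_expr set) \<Rightarrow> ('x, 'k) point set" where
  "resolvent_graph V r =
     (\<lambda>(n, A). (n, \<lambda>x. if x \<in> V then A x else rat_fun_eval (n, A) (r x))) ` resolvent_dom V r"

definition grr_with_resolvent ::
    "'x set \<Rightarrow> ('x \<Rightarrow> ('x, 'k::field) nc_rat_expr set) \<Rightarrow> ('x, 'k) nc_poly set \<Rightarrow> bool" where
  "grr_with_resolvent V r I \<longleftrightarrow>
     (\<forall>j\<in>- V. r j \<in> free_skew_field V) \<and>
     resolvent_graph V r \<subseteq> zero_locus I \<and>
     (\<forall>f. vanishes_on f (resolvent_graph V r) \<longrightarrow> vanishes_on f (zero_locus I))"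


section \<open>Generalized series over a matrix algebra\<close>

text \<open>
  Let \<open>E i j\<close> be the matrix units of the algebra of \<open>m \<times> m\<close> matrices. The free product of
  this algebra with the free algebra on the letters \<open>V\<close> has the basis

  \<open>E i a1 \<cdot> y1 \<cdot> E b1 a2 \<cdot> y2 \<cdot> E b2 a3 \<cdot> \<dots> \<cdot> yl \<cdot> E bl j\<close>,

  where \<open>[y1, \<dots>, yl]\<close> is a word in \<open>V\<close> and all indices are below \<open>m\<close>. For \<open>V\<close> finite, only
  finitely many basis elements have a given word length, so the elements of the completion are
  the arbitrary families of coefficients. If
  \<open>\<omega> = [(y1, a1, b1), \<dots>, (yl, al, bl)]\<close>, then \<open>S i \<omega> j\<close> is the coefficient of the basis
  element above in the series \<open>S\<close>; its word is \<open>map fst \<omega>\<close>.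
  Since \<open>E a q \<cdot> E q' b\<close> is \<open>E a b\<close> if \<open>q = q'\<close> and \<open>0\<close> otherwise, the product of the
  basis elements given by \<open>(i, \<omega>, q)\<close> and \<open>(q', \<omega>', j)\<close> is the one given by
  \<open>(i, \<omega> @ \<omega>', j)\<close> if \<open>q = q'\<close> and \<open>0\<close> otherwise.
\<close>

type_synonym ('x, 'k) gen_series = "nat \<Rightarrow> ('x \<times> nat \<times> nat) list \<Rightarrow> nat \<Rightarrow> 'k"

definition gen_series_ring :: "'x set \<Rightarrow> nat \<Rightarrow> ('x, 'k::field) gen_series ring" where
  "gen_series_ring V m = \<lparr>
     carrier = {S. \<forall>i \<omega> j. S i \<omega> j \<noteq> 0 \<longrightarrow>
                  i < m \<and> set \<omega> \<subseteq> V \<times> {..<m} \<times> {..<m} \<and> j < m},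
     mult = (\<lambda>S T i \<omega> j. \<Sum>p\<le>length \<omega>. \<Sum>q<m. S i (take p \<omega>) q * T q (drop p \<omega>) j),
     one = (\<lambda>i \<omega> j. if i < m \<and> \<omega> = [] \<and> i = j then 1 else 0),
     zero = (\<lambda>i \<omega> j. 0),
     add = (\<lambda>S T i \<omega> j. S i \<omega> j + T i \<omega> j)\<rparr>"

lemma sum_split_twice:
  fixes g :: "nat \<Rightarrow> nat \<Rightarrow> 'a::comm_monoid_add"
  shows "(\<Sum>p\<le>l. \<Sum>p'\<le>p. g p' p) = (\<Sum>p'\<le>l. \<Sum>e\<le>l - p'. g p' (p' + e))"
proof -
  have "(\<Sum>p\<le>l. \<Sum>p'\<le>p. g p' p) = (\<Sum>(p,p')\<in>(SIGMA p:{..l}. {..p}). g p' p)"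
    by (simp add: sum.Sigma)
  also have "\<dots> = (\<Sum>(p',e)\<in>(SIGMA p':{..l}. {..l - p'}). g p' (p' + e))"
    by (rule sum.reindex_bij_witness[where i="\<lambda>(p',e). (p'+e,p')" and j="\<lambda>(p,p'). (p', p-p')"]) auto
  also have "\<dots> = (\<Sum>p'\<le>l. \<Sum>e\<le>l - p'. g p' (p' + e))"
    by (simp add: sum.Sigma)
  finally show ?thesis .
qed

lemma ring_gen_series_ring: "ring (gen_series_ring V m :: ('x,'k::field) gen_series ring)"
  (is "ring ?R")
proof (rule ringI)
  show "abelian_group ?R"
  proof (rule abelian_groupI)
    fix S assume "S \<in> carrier ?R"
    then show "\<exists>T\<in>carrier ?R. T \<oplus>\<^bsub>?R\<^esub> S = \<zero>\<^bsub>?R\<^esub>"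
      by (intro bexI[of _ "\<lambda>i \<omega> j. - S i \<omega> j"]) (auto simp: gen_series_ring_def)
  next
    fix S T assume "S \<in> carrier ?R" "T \<in> carrier ?R"
    then show "S \<oplus>\<^bsub>?R\<^esub> T \<in> carrier ?R"
      by (simp add: gen_series_ring_def) (metis add.right_neutral)
  qed (auto simp: gen_series_ring_def algebra_simps)
next
  show "Group.monoid ?R"
  proof (rule monoidI)
    fix S T assume S: "S \<in> carrier ?R" and T: "T \<in> carrier ?R"
    show "S \<otimes>\<^bsub>?R\<^esub> T \<in> carrier ?R"
    proof -
      have "i < m \<and> set \<omega> \<subseteq> V \<times> {..<m} \<times> {..<m} \<and> j < m"
        if nz: "(\<Sum>p\<le>length \<omega>. \<Sum>q<m. S i (take p \<omega>) q * T q (drop p \<omega>) j) \<noteq> 0" for i \<omega> j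
      proof -
        obtain p where "(\<Sum>q<m. S i (take p \<omega>) q * T q (drop p \<omega>) j) \<noteq> 0"
          using nz by (meson sum.not_neutral_contains_not_neutral)
        then obtain q where "S i (take p \<omega>) q * T q (drop p \<omega>) j \<noteq> 0"
          by (meson sum.not_neutral_contains_not_neutral)
        then have "S i (take p \<omega>) q \<noteq> 0" "T q (drop p \<omega>) j \<noteq> 0" by auto
        then have "i < m" "j < m" "set (take p \<omega>) \<subseteq> V \<times> {..<m} \<times> {..<m}"
          "set (drop p \<omega>) \<subseteq> V \<times> {..<m} \<times> {..<m}"
          using S T by (auto simp: gen_series_ring_def)
        moreover have "set \<omega> = set (take p \<omega>) \<union> set (drop p \<omega>)"
          by (metis append_take_drop_id set_append)
        ultimately show ?thesis by auto
      qed
      then show ?thesis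
        unfolding gen_series_ring_def partial_object.simps monoid.simps mem_Collect_eq by blast
    qed
  next
    fix S T U :: "('x, 'k) gen_series"
    have "(\<Sum>p\<le>length \<omega>. \<Sum>q<m. (\<Sum>p'\<le>length (take p \<omega>). \<Sum>q'<m. S i (take p' (take p \<omega>)) q' * T q' (drop p' (take p \<omega>)) q) * U q (drop p \<omega>) j)
      = (\<Sum>p\<le>length \<omega>. \<Sum>q<m. S i (take p \<omega>) q * (\<Sum>p'\<le>length (drop p \<omega>). \<Sum>q'<m. T q (take p' (drop p \<omega>)) q' * U q' (drop p' (drop p \<omega>)) j))" (is "?l = ?r") for i j and \<omega> :: "('x \<times> nat \<times> nat) list"
    proof -
      define g where "g p' p = (\<Sum>q<m. \<Sum>q'<m. S i (take p' \<omega>) q' *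
        T q' (take (p - p') (drop p' \<omega>)) q * U q (drop p \<omega>) j)" for p' p
      have 1: "(\<Sum>q<m. (\<Sum>p'\<le>length (take p \<omega>). \<Sum>q'<m. S i (take p' (take p \<omega>)) q' *
          T q' (drop p' (take p \<omega>)) q) * U q (drop p \<omega>) j) = (\<Sum>p'\<le>p. g p' p)"
        if "p \<le> length \<omega>" for p
      proof -
        have "(\<Sum>q<m. (\<Sum>p'\<le>length (take p \<omega>). \<Sum>q'<m. S i (take p' (take p \<omega>)) q' *
          T q' (drop p' (take p \<omega>)) q) * U q (drop p \<omega>) j) =
          (\<Sum>p'\<le>length (take p \<omega>). \<Sum>q<m. \<Sum>q'<m. S i (take p' (take p \<omega>)) q' *
          T q' (drop p' (take p \<omega>)) q * U q (drop p \<omega>) j)"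
          unfolding sum_distrib_right by (rule sum.swap)
        also have "\<dots> = (\<Sum>p'\<le>p. g p' p)"
          unfolding g_def using that by (intro sum.cong) (simp_all add: drop_take min_def)
        finally show ?thesis .
      qed
      have 2: "(\<Sum>q<m. S i (take p \<omega>) q * (\<Sum>p'\<le>length (drop p \<omega>). \<Sum>q'<m.
          T q (take p' (drop p \<omega>)) q' * U q' (drop p' (drop p \<omega>)) j)) =
          (\<Sum>e\<le>length \<omega> - p. g p (p + e))" for p
      proof -
        have "(\<Sum>q<m. S i (take p \<omega>) q * (\<Sum>p'\<le>length (drop p \<omega>). \<Sum>q'<m.
          T q (take p' (drop p \<omega>)) q' * U q' (drop p' (drop p \<omega>)) j)) =
          (\<Sum>p'\<le>length (drop p \<omega>). \<Sum>q<m. \<Sum>q'<m. S i (take p \<omega>) q *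
          (T q (take p' (drop p \<omega>)) q' * U q' (drop p' (drop p \<omega>)) j))"
          unfolding sum_distrib_left by (rule sum.swap)
        also have "\<dots> = (\<Sum>e\<le>length (drop p \<omega>). g p (p + e))"
        proof (rule sum.cong[OF refl])
          fix e
          show "(\<Sum>q<m. \<Sum>q'<m. S i (take p \<omega>) q *
            (T q (take e (drop p \<omega>)) q' * U q' (drop e (drop p \<omega>)) j)) = g p (p + e)"
            unfolding g_def by (subst sum.swap) (simp only: drop_drop mult.assoc add.commute diff_add_inverse diff_add_inverse2)
        qed
        finally show ?thesis by simp
      qed
      have "?l = (\<Sum>p\<le>length \<omega>. \<Sum>p'\<le>p. g p' p)"
        by (rule sum.cong) (simp_all only: 1 atMost_iff)
      also have "\<dots> = (\<Sum>p'\<le>length \<omega>. \<Sum>e\<le>length \<omega> - p'. g p' (p' + e))"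
        by (rule sum_split_twice)
      also have "\<dots> = ?r"
        by (simp only: 2)
      finally show ?thesis .
    qed
    then show "S \<otimes>\<^bsub>?R\<^esub> T \<otimes>\<^bsub>?R\<^esub> U = S \<otimes>\<^bsub>?R\<^esub> (T \<otimes>\<^bsub>?R\<^esub> U)"
      by (intro ext) (simp only: gen_series_ring_def monoid.simps)
  next
    fix S assume S: "S \<in> carrier ?R"
    have "(\<Sum>p\<le>length \<omega>. \<Sum>q<m. (if i < m \<and> take p \<omega> = [] \<and> i = q then 1 else 0) * S q (drop p \<omega>) j) = S i \<omega> j" for i \<omega> j
    proof -
      have "(\<Sum>p\<le>length \<omega>. \<Sum>q<m. (if i < m \<and> take p \<omega> = [] \<and> i = q then 1 else 0) * S q (drop p \<omega>) j)
         = (\<Sum>p\<le>length \<omega>. if p = 0 then (if i < m then S i \<omega> j else 0) else 0)"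
        by (rule sum.cong, simp) (auto simp: if_distrib[of "\<lambda>x. x * _"] cong: if_cong intro!: sum.neutral)
      also have "\<dots> = S i \<omega> j" using S by (auto simp: gen_series_ring_def)
      finally show ?thesis .
    qed
    then show "\<one>\<^bsub>?R\<^esub> \<otimes>\<^bsub>?R\<^esub> S = S"
      by (intro ext) (simp only: gen_series_ring_def monoid.simps)
    have "(\<Sum>p\<le>length \<omega>. \<Sum>q<m. S i (take p \<omega>) q * (if q < m \<and> drop p \<omega> = [] \<and> q = j then 1 else 0)) = S i \<omega> j" for i \<omega> j
    proof -
      have "(\<Sum>p\<le>length \<omega>. \<Sum>q<m. S i (take p \<omega>) q * (if q < m \<and> drop p \<omega> = [] \<and> q = j then 1 else 0))
         = (\<Sum>p\<le>length \<omega>. if p = length \<omega> then (if j < m then S i \<omega> j else 0) else 0)"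
        by (rule sum.cong, simp) (auto simp: if_distrib[of "\<lambda>x. _ * x"] cong: if_cong intro!: sum.neutral)
      also have "\<dots> = S i \<omega> j" using S by (auto simp: gen_series_ring_def)
      finally show ?thesis .
    qed
    then show "S \<otimes>\<^bsub>?R\<^esub> \<one>\<^bsub>?R\<^esub> = S"
      by (intro ext) (simp only: gen_series_ring_def monoid.simps)
  qed (auto simp: gen_series_ring_def)
qed (auto simp: gen_series_ring_def fun_eq_iff algebra_simps sum.distrib)

definition const_series :: "nat \<Rightarrow> 'k::field mat \<Rightarrow> ('x, 'k) gen_series" where
  "const_series m M = (\<lambda>i \<omega> j. if i < m \<and> \<omega> = [] \<and> j < m then M $$ (i, j) else 0)"

text \<open>The letter \<open>x\<close> is the sum of all \<open>E a a \<cdot> x \<cdot> E b b\<close>.\<close>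

definition letter_series :: "nat \<Rightarrow> 'x \<Rightarrow> ('x, 'k::field) gen_series" where
  "letter_series m x = (\<lambda>i \<omega> j. if i < m \<and> \<omega> = [(x, i, j)] \<and> j < m then 1 else 0)"

definition word_component :: "'x list \<Rightarrow> ('x, 'k::field) gen_series \<Rightarrow> ('x, 'k) gen_series" where
  "word_component w S = (\<lambda>i \<omega> j. if map fst \<omega> = w then S i \<omega> j else 0)"

definition word_bimodule :: "'x set \<Rightarrow> nat \<Rightarrow> 'x list \<Rightarrow> ('x, 'k::field) gen_series set" where
  "word_bimodule V m w = {S \<in> carrier (gen_series_ring V m). word_component w S = S}"


subsection \<open>Expansion of a rational expression about a point\<close>

definition nc_expand ::
    "'x set \<Rightarrow> ('x, 'k::field) point \<Rightarrow> ('x, 'k) nc_poly \<Rightarrow> ('x, 'k) gen_series" where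
  "nc_expand V = (\<lambda>(m, P) f. let R = gen_series_ring V m in
     \<Oplus>\<^bsub>R\<^esub>w\<in>Poly_Mapping.keys f.
       const_series m (Poly_Mapping.lookup f w \<cdot>\<^sub>m 1\<^sub>m m) \<otimes>\<^bsub>R\<^esub>
       foldr (\<lambda>x S. (letter_series m x \<oplus>\<^bsub>R\<^esub> const_series m (P x)) \<otimes>\<^bsub>R\<^esub> S) (letters w) \<one>\<^bsub>R\<^esub>)"

text \<open>Only meaningful for expressions defined at the point, as all inverses exist then.\<close>

primrec rat_expand ::
    "'x set \<Rightarrow> ('x, 'k::field) point \<Rightarrow> ('x, 'k) nc_rat_expr \<Rightarrow> ('x, 'k) gen_series" where
  "rat_expand V p (Pol f) = nc_expand V p f"
| "rat_expand V p (Add s t) =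
     rat_expand V p s \<oplus>\<^bsub>gen_series_ring V (fst p)\<^esub> rat_expand V p t"
| "rat_expand V p (Mul s t) =
     rat_expand V p s \<otimes>\<^bsub>gen_series_ring V (fst p)\<^esub> rat_expand V p t"
| "rat_expand V p (Inv s) = inv\<^bsub>gen_series_ring V (fst p)\<^esub> (rat_expand V p s)"


subsection \<open>Linear representations and realizations\<close>

text \<open>Rows, columns and matrices of dimension \<open>d\<close> over the series are functions of indices below \<open>d\<close>.\<close>

definition linear_representation ::
    "'x set \<Rightarrow> nat \<Rightarrow> nat \<Rightarrow> (nat \<Rightarrow> ('x, 'k::field) gen_series) \<Rightarrow>
     ('x \<Rightarrow> nat \<Rightarrow> nat \<Rightarrow> ('x, 'k) gen_series) \<Rightarrow> (nat \<Rightarrow> ('x, 'k) gen_series) \<Rightarrow> bool" where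
  "linear_representation V m d c A b \<longleftrightarrow>
     (\<forall>i<d. c i \<in> word_bimodule V m [] \<and> b i \<in> word_bimodule V m []) \<and>
     (\<forall>x\<in>V. \<forall>i<d. \<forall>j<d. A x i j \<in> word_bimodule V m [x])"

primrec word_matrix ::
    "('s, 'z) ring_scheme \<Rightarrow> nat \<Rightarrow> ('x \<Rightarrow> nat \<Rightarrow> nat \<Rightarrow> 's) \<Rightarrow> 'x list \<Rightarrow> nat \<Rightarrow> nat \<Rightarrow> 's" where
  "word_matrix R d A [] = (\<lambda>i j. if i = j then \<one>\<^bsub>R\<^esub> else \<zero>\<^bsub>R\<^esub>)"
| "word_matrix R d A (x # w) = (\<lambda>i j. \<Oplus>\<^bsub>R\<^esub>l\<in>{..<d}. A x i l \<otimes>\<^bsub>R\<^esub> word_matrix R d A w l j)"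

definition represents ::
    "'x set \<Rightarrow> nat \<Rightarrow> nat \<Rightarrow> (nat \<Rightarrow> ('x, 'k::field) gen_series) \<Rightarrow>
     ('x \<Rightarrow> nat \<Rightarrow> nat \<Rightarrow> ('x, 'k) gen_series) \<Rightarrow> (nat \<Rightarrow> ('x, 'k) gen_series) \<Rightarrow>
     ('x, 'k) gen_series \<Rightarrow> bool" where
  "represents V m d c A b S \<longleftrightarrow> (let R = gen_series_ring V m in
     \<forall>w\<in>lists V. word_component w S =
       (\<Oplus>\<^bsub>R\<^esub>i\<in>{..<d}. \<Oplus>\<^bsub>R\<^esub>j\<in>{..<d}. c i \<otimes>\<^bsub>R\<^esub> word_matrix R d A w i j \<otimes>\<^bsub>R\<^esub> b j))"

definition has_realization ::
    "'x set \<Rightarrow> ('x, 'k::field) point \<Rightarrow> ('x, 'k) nc_rat_expr \<Rightarrow> nat \<Rightarrow> bool" where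
  "has_realization V p s d \<longleftrightarrow> p \<in> expr_dom V s \<and>
     (\<exists>c A b. linear_representation V (fst p) d c A b \<and>
              represents V (fst p) d c A b (rat_expand V p s))"

end

theory Submission
  imports
    Defs
    "HOL-Library.Function_Algebras"
    "HOL-Computational_Algebra.Polynomial_FPS"
begin

text \<open>
  Substitute into \<open>f\<close>, for the letters outside \<open>V\<close>, rational expressions for the resolvent that
  have realizations of dimension at most \<open>n\<close> about \<open>P\<close>. The result is a rational expression
  \<open>F\<close>, and \<open>f\<close> vanishes on the graph of the resolvent iff \<open>F\<close> vanishes. So the theorem is an
  identity test for \<open>F\<close>. Its proof gives contradictory bounds for the length of a shortest word
  on which the expansion \<open>S\<close> of \<open>F\<close> at \<open>P\<close> has a nonzero coefficient.

  A realization gives a finite-dimensional space of states on which the letters act. Dimensions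
  add for sums and products of series, and a letter needs dimension 2; therefore the \<open>v\<close> terms
  with at most \<open>u\<close> factors each give \<open>S\<close> a space of states of dimension at most
  \<open>H = m u v max(n, 2)\<close> over the field (\<open>shift_dim_le_substitute_words\<close>), where the factor \<open>m\<close> is
  the dimension over the field of a row of an \<open>m \<times> m\<close> matrix. By a Cayley-Hamilton type of
  argument, \<open>S\<close> is zero if it is zero on all words shorter than \<open>H\<close>
  (\<open>zero_if_zero_on_short_words\<close>).

  On the other hand, let \<open>L = \<lceil>H / 2\<rceil>\<close> and consider the line \<open>t \<mapsto> P \<otimes> 1 + t Y\<close> of tuples of size
  \<open>m L = N\<close>, with \<open>Y\<close> arbitrary. On it \<open>F\<close> is a rational function of \<open>t\<close>, defined at \<open>t = 0\<close>,
  and its Taylor coefficient at \<open>t\<^sup>h\<close> is obtained by evaluating the part of degree \<open>h\<close> of \<open>S\<close> at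
  the blocks of \<open>Y\<close> of size \<open>L\<close> (\<open>rat_expr_on_line\<close>). If \<open>f\<close> vanishes on the points of size
  \<open>N\<close>, then all these coefficients are zero. But a nonzero noncommutative polynomial of degree
  less than \<open>2 L\<close> does not vanish on the matrices of size \<open>L\<close>
  (\<open>homogeneous_zero_if_vanishing_on_matrices\<close>). As \<open>H \<le> 2 L\<close>, this gives \<open>S = 0\<close>.

  Finally \<open>S = 0\<close> says that \<open>F\<close> vanishes on every line through an amplification \<open>P \<otimes> 1\<close>. For a
  point \<open>Q\<close> of the domain of the resolvent, the line from \<open>P \<otimes> 1\<close> to \<open>Q \<otimes> 1\<close> carries the
  vanishing to \<open>Q\<close>. The expressions defined at \<open>Q\<close> may differ from those defined at \<open>P\<close>, but a
  rational function of one variable does not notice the change on finitely many points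
  (\<open>vanishes_on_graph_if_series_zero\<close>). The same argument shows that the value of a rational
  function does not depend on the expression (\<open>rat_expr_agree_trans\<close>).
\<close>

section \<open>Words of a fixed length and the staircase of matrix units\<close>

definition words_over :: "'y set \<Rightarrow> nat \<Rightarrow> 'y list set" where
  "words_over \<Sigma> h = {\<omega>. set \<omega> \<subseteq> \<Sigma> \<and> length \<omega> = h}"

lemma finite_words_over: "finite \<Sigma> \<Longrightarrow> finite (words_over \<Sigma> h)"
  unfolding words_over_def by (rule finite_lists_length_eq)

lemma words_over_0 [simp]: "words_over \<Sigma> 0 = {[]}"
  by (auto simp: words_over_def)

lemma sum_words_over_split:
  assumes "p \<le> h"
  shows "(\<Sum>\<omega>\<in>words_over \<Sigma> h. g (take p \<omega>) (drop p \<omega>)) =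
    (\<Sum>\<omega>\<in>words_over \<Sigma> p. \<Sum>\<omega>'\<in>words_over \<Sigma> (h - p). g \<omega> \<omega>')"
proof -
  have "(\<Sum>\<omega>\<in>words_over \<Sigma> h. g (take p \<omega>) (drop p \<omega>)) =
    (\<Sum>(\<omega>, \<omega>')\<in>words_over \<Sigma> p \<times> words_over \<Sigma> (h - p). g \<omega> \<omega>')"
    by (rule sum.reindex_bij_witness[where i = "\<lambda>(\<omega>, \<omega>'). \<omega> @ \<omega>'"
          and j = "\<lambda>\<omega>. (take p \<omega>, drop p \<omega>)"])
      (use assms in \<open>auto simp: words_over_def min_def subset_iff dest: in_set_takeD in_set_dropD\<close>)
  then show ?thesis
    by (simp add: sum.cartesian_product)
qed

lemma sum_words_over_Suc:
  "(\<Sum>\<omega>\<in>words_over \<Sigma> (Suc h). g \<omega>) = (\<Sum>y\<in>\<Sigma>. \<Sum>\<omega>\<in>words_over \<Sigma> h. g (y # \<omega>))"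
proof -
  have "(\<Sum>\<omega>\<in>words_over \<Sigma> (Suc h). g \<omega>) = (\<Sum>(y, \<omega>)\<in>\<Sigma> \<times> words_over \<Sigma> h. g (y # \<omega>))"
    by (rule sum.reindex_bij_witness[where i = "\<lambda>(y, \<omega>). y # \<omega>" and j = "\<lambda>\<omega>. (hd \<omega>, tl \<omega>)"])
      (auto simp: words_over_def length_Suc_conv)
  then show ?thesis
    by (simp add: sum.cartesian_product)
qed

text \<open>
  Square matrices of size \<open>L\<close> are functions of two indices here: only sums over indices below
  \<open>L\<close> occur, and the words act on the blocks of larger matrices.
\<close>

primrec path_prod :: "nat \<Rightarrow> ('y \<Rightarrow> nat \<Rightarrow> nat \<Rightarrow> 'k::comm_ring_1) \<Rightarrow> 'y list \<Rightarrow> nat \<Rightarrow> nat \<Rightarrow> 'k" where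
  "path_prod L Y [] = (\<lambda>r s. if r = s then 1 else 0)"
| "path_prod L Y (y # \<omega>) = (\<lambda>r s. \<Sum>q<L. Y y r q * path_prod L Y \<omega> q s)"

lemma path_prod_append:
  assumes "r < L"
  shows "path_prod L Y (\<omega> @ \<omega>') r s = (\<Sum>q<L. path_prod L Y \<omega> r q * path_prod L Y \<omega>' q s)"
  using assms
proof (induction \<omega> arbitrary: r)
  case Nil
  have "(\<Sum>q<L. path_prod L Y [] r q * path_prod L Y \<omega>' q s) =
    (\<Sum>q<L. if q = r then path_prod L Y \<omega>' q s else 0)"
    by (rule sum.cong) auto
  then show ?case
    using Nil by simp
next
  case (Cons y \<omega>)
  have "path_prod L Y ((y # \<omega>) @ \<omega>') r s =
    (\<Sum>p<L. \<Sum>q<L. Y y r p * path_prod L Y \<omega> p q * path_prod L Y \<omega>' q s)"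
    by (simp add: Cons.IH sum_distrib_left mult.assoc)
  also have "\<dots> = (\<Sum>q<L. path_prod L Y (y # \<omega>) r q * path_prod L Y \<omega>' q s)"
    by (subst sum.swap) (simp add: sum_distrib_right)
  finally show ?case .
qed

text \<open>
  Expanding the products of the sums \<open>Y y = \<Sum>k\<in>T, v k = y. U k\<close> turns a polynomial in the
  letters \<open>y\<close> into one in the indices \<open>k\<close>.
\<close>

lemma sum_path_prod_substitute:
  fixes c :: "'y list \<Rightarrow> 'k::comm_ring_1" and v :: "nat \<Rightarrow> 'y" and U :: "nat \<Rightarrow> nat \<Rightarrow> nat \<Rightarrow> 'k"
  assumes fin: "finite T" "finite \<Sigma>" and v: "v ` T \<subseteq> \<Sigma>"
  defines "Y \<equiv> \<lambda>y r q. \<Sum>k\<in>T. if v k = y then U k r q else 0"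
  shows "(\<Sum>\<omega>\<in>words_over \<Sigma> h. c \<omega> * path_prod L Y \<omega> r s) =
    (\<Sum>\<kappa>\<in>words_over T h. c (map v \<kappa>) * path_prod L U \<kappa> r s)"
proof (induction h arbitrary: c r)
  case 0
  then show ?case by simp
next
  case (Suc h)
  define G where "G y q = (\<Sum>\<omega>\<in>words_over \<Sigma> h. c (y # \<omega>) * path_prod L Y \<omega> q s)" for y q
  have G: "G y q = (\<Sum>\<kappa>\<in>words_over T h. c (y # map v \<kappa>) * path_prod L U \<kappa> q s)" for y q
    unfolding G_def by (rule Suc.IH)
  have pull: "(\<Sum>\<omega>\<in>A. a \<omega> * (\<Sum>q<L. x q * b \<omega> q)) = (\<Sum>q<L. x q * (\<Sum>\<omega>\<in>A. a \<omega> * b \<omega> q))"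
    for A :: "'z set" and a x and b :: "'z \<Rightarrow> nat \<Rightarrow> 'k"
    unfolding sum_distrib_left by (subst sum.swap) (simp add: mult_ac)
  have "(\<Sum>\<omega>\<in>words_over \<Sigma> (Suc h). c \<omega> * path_prod L Y \<omega> r s) = (\<Sum>y\<in>\<Sigma>. \<Sum>q<L. Y y r q * G y q)"
    by (simp add: sum_words_over_Suc pull G_def)
  also have "\<dots> = (\<Sum>y\<in>\<Sigma>. \<Sum>q<L. \<Sum>k\<in>T. if y = v k then U k r q * G y q else 0)"
    unfolding Y_def sum_distrib_right by (intro sum.cong) auto
  also have "\<dots> = (\<Sum>y\<in>\<Sigma>. \<Sum>k\<in>T. \<Sum>q<L. if y = v k then U k r q * G y q else 0)"
    by (rule sum.cong[OF refl], rule sum.swap)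
  also have "\<dots> = (\<Sum>k\<in>T. \<Sum>q<L. \<Sum>y\<in>\<Sigma>. if y = v k then U k r q * G y q else 0)"
    by (subst sum.swap) (rule sum.cong[OF refl], rule sum.swap)
  also have "\<dots> = (\<Sum>k\<in>T. \<Sum>q<L. U k r q * G (v k) q)"
    using v by (intro sum.cong refl) (simp add: fin image_subset_iff)
  also have "\<dots> = (\<Sum>\<kappa>\<in>words_over T (Suc h). c (map v \<kappa>) * path_prod L U \<kappa> r s)"
    by (simp add: sum_words_over_Suc pull G)
  finally show ?case .
qed

text \<open>
  The matrix units at the positions (0, 0), (0, 1), (1, 1), (1, 2), and so on: two consecutive
  factors of a nonzero product are equal or move down the staircase, so the indices never decrease.
\<close>

definition staircase :: "nat \<Rightarrow> nat \<Rightarrow> nat \<Rightarrow> 'k::comm_ring_1" where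
  "staircase k r q = (if r = k div 2 \<and> q = (k + 1) div 2 then 1 else 0)"

lemma sorted_if_staircase_prod_nonzero:
  assumes "path_prod L staircase \<kappa> r s \<noteq> (0::'k::comm_ring_1)"
  shows "sorted \<kappa>"
proof -
  have "sorted \<kappa> \<and> (\<forall>k\<in>set \<kappa>. 2 * r \<le> k)"
    using assms
  proof (induction \<kappa> arbitrary: r)
    case (Cons k \<kappa>)
    then obtain q where q: "staircase k r q * path_prod L staircase \<kappa> q s \<noteq> (0::'k)"
      by (auto elim: sum.not_neutral_contains_not_neutral)
    then have rq: "r = k div 2" "q = (k + 1) div 2"
      by (auto simp: staircase_def split: if_splits)
    have IH: "sorted \<kappa>" "\<forall>l\<in>set \<kappa>. 2 * q \<le> l"
      using Cons.IH[of q] q by (metis mult_zero_right)+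
    have "2 * r \<le> k" "k \<le> 2 * q"
      unfolding rq by linarith+
    then have "\<forall>l\<in>set \<kappa>. k \<le> l"
      using IH(2) by (meson le_trans)
    then show ?case
      using IH \<open>2 * r \<le> k\<close> by force
  qed simp
  then show ?thesis ..
qed

lemma staircase_prod_upt:
  assumes "k \<le> h" "h < 2 * L"
  shows "path_prod L staircase [k..<h] (k div 2) (h div 2) = (1::'k::comm_ring_1)"
  using assms
proof (induction k rule: inc_induct)
  case (step k)
  have "path_prod L staircase [k..<h] (k div 2) (h div 2) =
    (\<Sum>q<L. if q = Suc k div 2 then path_prod L staircase [Suc k..<h] q (h div 2) else (0::'k))"
    using step.hyps
    by (subst upt_conv_Cons, simp, unfold path_prod.simps, intro sum.cong refl) (simp add: staircase_def)
  also have "\<dots> = 1"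
    using step by simp
  finally show ?case .
qed simp

text \<open>
  Substituting for a letter \<open>y\<close> the sum of the staircase units whose place in the given word is
  occupied by \<open>y\<close>, the alternating sum over all sets of places keeps only the products in which
  every unit occurs once. Such a product vanishes unless the units come in their order, so that
  only the coefficient of the given word survives. The alternating sum replaces the
  multilinearization of the polynomial.
\<close>

lemma homogeneous_zero_if_vanishing_on_matrices:
  fixes c :: "'y list \<Rightarrow> 'k::comm_ring_1"
  assumes fin: "finite \<Sigma>" and h: "h < 2 * L"
    and vanish: "\<And>Y r s. r < L \<Longrightarrow> s < L \<Longrightarrow> (\<Sum>\<omega>\<in>words_over \<Sigma> h. c \<omega> * path_prod L Y \<omega> r s) = 0"
    and \<omega>\<^sub>0: "\<omega>\<^sub>0 \<in> words_over \<Sigma> h"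
  shows "c \<omega>\<^sub>0 = 0"
proof -
  have len: "length \<omega>\<^sub>0 = h" and sub: "set \<omega>\<^sub>0 \<subseteq> \<Sigma>"
    using \<omega>\<^sub>0 by (auto simp: words_over_def)
  \<comment> \<open>\<open>F U\<close> collects the products in which exactly the units with places in \<open>U\<close> occur, and \<open>G T\<close>
    those with all places in \<open>T\<close>, so that \<open>F\<close> is the Moebius inverse of \<open>G\<close>.\<close>
  define a :: "nat list \<Rightarrow> 'k" where
    "a \<kappa> = c (map ((!) \<omega>\<^sub>0) \<kappa>) * path_prod L staircase \<kappa> 0 (h div 2)" for \<kappa>
  define F where "F U = (\<Sum>\<kappa> | set \<kappa> = U \<and> length \<kappa> = h. if U \<subseteq> {..<h} then a \<kappa> else 0)" for U
  define G where "G T = (\<Sum>U\<in>Pow T. F U)" for T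
  have G0: "G T = 0" if T: "T \<subseteq> {..<h}" for T
  proof -
    have finT: "finite T"
      using T finite_subset by blast
    have img: "(!) \<omega>\<^sub>0 ` T \<subseteq> \<Sigma>"
      using T sub len by (auto simp: subset_iff)
    have "0 = (\<Sum>\<kappa>\<in>words_over T h. a \<kappa>)"
      using sum_path_prod_substitute[OF finT fin img, where h = h and c = c and L = L and U = staircase and r = 0 and s = "h div 2"]
        vanish[of 0 "h div 2"] h unfolding a_def by simp
    also have "\<dots> = (\<Sum>U\<in>Pow T. \<Sum>\<kappa>\<in>{\<kappa> \<in> words_over T h. set \<kappa> = U}. a \<kappa>)"
      by (rule sum.group[symmetric]) (use finT in \<open>auto simp: finite_words_over, auto simp: words_over_def\<close>)
    also have "\<dots> = G T"
      unfolding G_def F_def using T by (intro sum.cong refl) (auto simp: words_over_def)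
    finally show ?thesis by simp
  qed
  have "F {..<h} = (\<Sum>T \<in> Pow {..<h}. (-1) ^ (card {..<h} - card T) * G T)"
    by (rule inclusion_exclusion_mobius) (simp_all add: G_def)
  also have "\<dots> = 0"
    by (simp add: G0)
  finally have "F {..<h} = 0" .
  moreover have "F {..<h} = (\<Sum>\<kappa>\<in>{[0..<h]}. a \<kappa>)"
    unfolding F_def
  proof (rule sum.mono_neutral_cong_right)
    show "finite {\<kappa>. set \<kappa> = {..<h} \<and> length \<kappa> = h}"
      by (rule finite_subset[OF _ finite_lists_length_eq[of "{..<h}" h]]) auto
    show "{[0..<h]} \<subseteq> {\<kappa>. set \<kappa> = {..<h} \<and> length \<kappa> = h}"
      by auto
    show "\<forall>\<kappa>\<in>{\<kappa>. set \<kappa> = {..<h} \<and> length \<kappa> = h} - {[0..<h]}. (if {..<h} \<subseteq> {..<h} then a \<kappa> else 0) = 0"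
    proof
      fix \<kappa> assume "\<kappa> \<in> {\<kappa>. set \<kappa> = {..<h} \<and> length \<kappa> = h} - {[0..<h]}"
      then have \<kappa>: "set \<kappa> = {..<h}" "length \<kappa> = h" "\<kappa> \<noteq> [0..<h]"
        by auto
      \<comment> \<open>A word of length \<open>h\<close> in which all \<open>h\<close> units occur is a permutation of them.\<close>
      have "distinct \<kappa>"
        using \<kappa>(1,2) by (intro card_distinct) simp
      then have "\<not> sorted \<kappa>"
        using \<kappa>(1,3) sorted_distinct_set_unique[of \<kappa> "[0..<h]"] by (auto simp: atLeast0LessThan)
      then have "path_prod L staircase \<kappa> 0 (h div 2) = (0::'k)"
        using sorted_if_staircase_prod_nonzero by blast
      then show "(if {..<h} \<subseteq> {..<h} then a \<kappa> else 0) = 0"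
        unfolding a_def by simp
    qed
  qed simp
  moreover have "a [0..<h] = c \<omega>\<^sub>0"
    using staircase_prod_upt[of 0 h L, where ?'k = 'k] h map_nth[of \<omega>\<^sub>0] len unfolding a_def by simp
  ultimately show ?thesis by simp
qed


section \<open>The ring of generalized series\<close>

lemma gen_series_ring_simps:
  "\<zero>\<^bsub>gen_series_ring V m\<^esub> = (\<lambda>i \<omega> j. 0)"
  "\<one>\<^bsub>gen_series_ring V m\<^esub> = (\<lambda>i \<omega> j. if i < m \<and> \<omega> = [] \<and> i = j then 1 else 0)"
  "S \<oplus>\<^bsub>gen_series_ring V m\<^esub> T = (\<lambda>i \<omega> j. S i \<omega> j + T i \<omega> j)"
  by (simp_all add: gen_series_ring_def)

lemma mem_gen_series_ring:
  "S \<in> carrier (gen_series_ring V m) \<longleftrightarrow>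
    (\<forall>i \<omega> j. S i \<omega> j \<noteq> 0 \<longrightarrow> i < m \<and> set \<omega> \<subseteq> V \<times> {..<m} \<times> {..<m} \<and> j < m)"
  by (simp add: gen_series_ring_def)

lemma gen_series_mult:
  "(S \<otimes>\<^bsub>gen_series_ring V m\<^esub> T) i \<omega> j =
    (\<Sum>p\<le>length \<omega>. \<Sum>q<m. S i (take p \<omega>) q * T q (drop p \<omega>) j)"
  by (simp add: gen_series_ring_def)

lemma gen_series_mult_Nil:
  "(S \<otimes>\<^bsub>gen_series_ring V m\<^esub> T) i [] j = (\<Sum>q<m. S i [] q * T q [] j)"
  by (simp add: gen_series_mult)

text \<open>Either the whole word is read by \<open>T\<close>, or its first letter is read by \<open>S\<close>.\<close>

lemma gen_series_mult_Cons:
  "(S \<otimes>\<^bsub>gen_series_ring V m\<^esub> T) i (y # \<omega>) j =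
    (\<Sum>q<m. S i [] q * T q (y # \<omega>) j) +
    ((\<lambda>i \<omega>. S i (y # \<omega>)) \<otimes>\<^bsub>gen_series_ring V m\<^esub> T) i \<omega> j"
  by (simp add: gen_series_mult sum.atMost_Suc_shift del: sum.atMost_Suc)

lemma gen_series_mult_left_const:
  assumes "\<And>\<omega> q. \<omega> \<noteq> [] \<Longrightarrow> C i \<omega> q = 0"
  shows "(C \<otimes>\<^bsub>gen_series_ring V m\<^esub> S) i \<omega> j = (\<Sum>q<m. C i [] q * S q \<omega> j)"
proof (cases \<omega>)
  case (Cons y \<omega>')
  then show ?thesis
    unfolding Cons gen_series_mult_Cons using assms by (simp add: gen_series_mult)
qed (simp add: gen_series_mult_Nil)

lemma gen_series_mult_right_const:
  assumes "\<And>q \<omega>. \<omega> \<noteq> [] \<Longrightarrow> C q \<omega> j = 0"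
  shows "(S \<otimes>\<^bsub>gen_series_ring V m\<^esub> C) i \<omega> j = (\<Sum>q<m. S i \<omega> q * C q [] j)"
proof -
  have "(S \<otimes>\<^bsub>gen_series_ring V m\<^esub> C) i \<omega> j =
    (\<Sum>p\<le>length \<omega>. if p = length \<omega> then \<Sum>q<m. S i \<omega> q * C q [] j else 0)"
    unfolding gen_series_mult using assms by (intro sum.cong) auto
  then show ?thesis by simp
qed

lemma gen_series_finsum:
  assumes "finite K" "\<And>a. a \<in> K \<Longrightarrow> F a \<in> carrier (gen_series_ring V m)"
  shows "(\<Oplus>\<^bsub>gen_series_ring V m\<^esub>a\<in>K. F a) = (\<lambda>i \<omega> j. \<Sum>a\<in>K. F a i \<omega> j)"
    and "(\<Oplus>\<^bsub>gen_series_ring V m\<^esub>a\<in>K. F a) \<in> carrier (gen_series_ring V m)"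
proof -
  interpret ring "gen_series_ring V m" by (rule ring_gen_series_ring)
  show "(\<Oplus>\<^bsub>gen_series_ring V m\<^esub>a\<in>K. F a) = (\<lambda>i \<omega> j. \<Sum>a\<in>K. F a i \<omega> j)"
    using assms by induction (simp_all add: gen_series_ring_simps Pi_iff)
  show "(\<Oplus>\<^bsub>gen_series_ring V m\<^esub>a\<in>K. F a) \<in> carrier (gen_series_ring V m)"
    using assms by (intro finsum_closed) auto
qed

lemma const_series_carrier: "const_series m M \<in> carrier (gen_series_ring V m)"
  by (auto simp: mem_gen_series_ring const_series_def split: if_splits)

lemma letter_series_carrier: "x \<in> V \<Longrightarrow> letter_series m x \<in> carrier (gen_series_ring V m)"
  by (auto simp: mem_gen_series_ring letter_series_def split: if_splits)


subsection \<open>Series with an invertible constant term\<close>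

text \<open>
  The coefficients of a right inverse, found from the shorter words to the longer ones; \<open>C\<close> is
  the inverse of the constant term of \<open>S\<close>.
\<close>

fun right_inverse_series ::
    "nat \<Rightarrow> 'k::field mat \<Rightarrow> ('x, 'k) gen_series \<Rightarrow> ('x \<times> nat \<times> nat) list \<Rightarrow> nat \<Rightarrow> nat \<Rightarrow> 'k" where
  "right_inverse_series m C S [] = (\<lambda>i j. if i < m \<and> j < m then C $$ (i, j) else 0)"
| "right_inverse_series m C S (y # \<omega>) = (\<lambda>i j. if i < m \<and> j < m then
     - (\<Sum>q<m. C $$ (i, q) * (\<Sum>p\<le>length \<omega>. \<Sum>q'<m.
         S q (y # take p \<omega>) q' * right_inverse_series m C S (drop p \<omega>) q' j)) else 0)"

lemma right_inverse_series_support: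
  assumes S: "S \<in> carrier (gen_series_ring V m)"
    and "right_inverse_series m C S \<omega> i j \<noteq> 0"
  shows "i < m \<and> set \<omega> \<subseteq> V \<times> {..<m} \<times> {..<m} \<and> j < m"
  using assms(2)
proof (induction "length \<omega>" arbitrary: \<omega> i j rule: less_induct)
  case less
  show ?case
  proof (cases \<omega>)
    case Nil
    then show ?thesis using less.prems by (auto split: if_splits)
  next
    case (Cons y \<omega>')
    have ij: "i < m" "j < m"
      and ne: "(\<Sum>q<m. C $$ (i, q) * (\<Sum>p\<le>length \<omega>'. \<Sum>q'<m.
         S q (y # take p \<omega>') q' * right_inverse_series m C S (drop p \<omega>') q' j)) \<noteq> 0"
      using less.prems Cons by (auto split: if_splits)
    obtain q where "C $$ (i, q) * (\<Sum>p\<le>length \<omega>'. \<Sum>q'<m.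
         S q (y # take p \<omega>') q' * right_inverse_series m C S (drop p \<omega>') q' j) \<noteq> 0"
      using ne by (rule sum.not_neutral_contains_not_neutral)
    then have "(\<Sum>p\<le>length \<omega>'. \<Sum>q'<m.
         S q (y # take p \<omega>') q' * right_inverse_series m C S (drop p \<omega>') q' j) \<noteq> 0"
      by auto
    then obtain p where "(\<Sum>q'<m. S q (y # take p \<omega>') q' * right_inverse_series m C S (drop p \<omega>') q' j) \<noteq> 0"
      by (meson sum.not_neutral_contains_not_neutral)
    then obtain q' where "S q (y # take p \<omega>') q' * right_inverse_series m C S (drop p \<omega>') q' j \<noteq> 0"
      by (meson sum.not_neutral_contains_not_neutral)
    then have nz: "S q (y # take p \<omega>') q' \<noteq> 0" "right_inverse_series m C S (drop p \<omega>') q' j \<noteq> 0"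
      by auto
    have "set (y # take p \<omega>') \<subseteq> V \<times> {..<m} \<times> {..<m}"
      using S nz(1) unfolding mem_gen_series_ring by blast
    moreover have "set (drop p \<omega>') \<subseteq> V \<times> {..<m} \<times> {..<m}"
      using less.hyps[OF _ nz(2)] Cons by simp
    moreover have "set \<omega>' = set (take p \<omega>') \<union> set (drop p \<omega>')"
      by (metis append_take_drop_id set_append)
    ultimately show ?thesis
      using ij Cons by auto
  qed
qed

lemma exists_right_inverse_series:
  assumes S: "S \<in> carrier (gen_series_ring V m)"
    and B: "B \<in> carrier_mat m m" and C: "C \<in> carrier_mat m m" and BC: "B * C = 1\<^sub>m m"
    and SB: "\<And>i j. i < m \<Longrightarrow> j < m \<Longrightarrow> S i [] j = B $$ (i, j)"
  shows "\<exists>T\<in>carrier (gen_series_ring V m). S \<otimes>\<^bsub>gen_series_ring V m\<^esub> T = \<one>\<^bsub>gen_series_ring V m\<^esub> \<and>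
    (\<forall>i<m. \<forall>j<m. T i [] j = C $$ (i, j))"
proof -
  define T where "T i \<omega> j = right_inverse_series m C S \<omega> i j" for i \<omega> j
  have T: "T \<in> carrier (gen_series_ring V m)"
    using right_inverse_series_support[OF S] by (auto simp: mem_gen_series_ring T_def)
  have BC': "(\<Sum>q<m. B $$ (i, q) * C $$ (q, j)) = (if i = j then 1 else 0)" if "i < m" "j < m" for i j
    using arg_cong[OF BC, of "\<lambda>M. M $$ (i, j)"] B C that by (simp add: scalar_prod_def lessThan_atLeast0)
  have T0: "T i \<omega> j = 0" if "\<not> (i < m \<and> j < m)" for i \<omega> j
    using T that by (auto simp: mem_gen_series_ring)
  have S0: "S i \<omega> j = 0" if "\<not> (i < m \<and> j < m)" for i \<omega> j
    using S that by (auto simp: mem_gen_series_ring)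
  have "(S \<otimes>\<^bsub>gen_series_ring V m\<^esub> T) i \<omega> j = \<one>\<^bsub>gen_series_ring V m\<^esub> i \<omega> j" for i \<omega> j
  proof (cases "i < m \<and> j < m")
    case False
    then show ?thesis
      using S0[of i] T0[of _ j] by (auto simp: gen_series_mult gen_series_ring_simps)
  next
    case ij: True
    show ?thesis
    proof (cases \<omega>)
      case Nil
      then show ?thesis
        using ij SB BC' by (simp add: gen_series_mult_Nil gen_series_ring_simps T_def)
    next
      case (Cons y \<omega>')
      define X where "X q = ((\<lambda>i \<omega>. S i (y # \<omega>)) \<otimes>\<^bsub>gen_series_ring V m\<^esub> T) q \<omega>' j" for q
      have TX: "T q (y # \<omega>') j = - (\<Sum>q'<m. C $$ (q, q') * X q')" if "q < m" for q
        using that ij by (simp add: T_def X_def gen_series_mult)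
      have "(\<Sum>q<m. S i [] q * T q (y # \<omega>') j) = (\<Sum>q<m. - (\<Sum>q'<m. B $$ (i, q) * C $$ (q, q') * X q'))"
        using ij by (intro sum.cong) (auto simp: TX SB sum_distrib_left mult.assoc)
      also have "\<dots> = - (\<Sum>q'<m. \<Sum>q<m. B $$ (i, q) * C $$ (q, q') * X q')"
        unfolding sum_negf by (subst sum.swap) simp
      also have "\<dots> = - (\<Sum>q'<m. (if i = q' then 1 else 0) * X q')"
        unfolding sum_distrib_right[symmetric] using ij by (simp add: BC')
      also have "\<dots> = - (\<Sum>q'<m. if q' = i then X q' else 0)"
        by (intro arg_cong[of _ _ uminus] sum.cong) auto
      also have "\<dots> = - X i"
        using ij by simp
      finally show ?thesis
        by (simp add: Cons gen_series_mult_Cons X_def[symmetric] gen_series_ring_simps)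
    qed
  qed
  then have "S \<otimes>\<^bsub>gen_series_ring V m\<^esub> T = \<one>\<^bsub>gen_series_ring V m\<^esub>"
    by (intro ext) simp
  then show ?thesis
    using T by (intro bexI[of _ T]) (auto simp: T_def)
qed

text \<open>
  The constant term of a right inverse is invertible too, so that the right inverse has a right
  inverse, which can only be the given series.
\<close>

lemma gen_series_unit:
  assumes S: "S \<in> carrier (gen_series_ring V m)"
    and B: "B \<in> carrier_mat m m" and C: "C \<in> carrier_mat m m"
    and BC: "B * C = 1\<^sub>m m" and CB: "C * B = 1\<^sub>m m"
    and SB: "\<And>i j. i < m \<Longrightarrow> j < m \<Longrightarrow> S i [] j = B $$ (i, j)"
  shows "S \<in> Units (gen_series_ring V m)"
    and "i < m \<Longrightarrow> j < m \<Longrightarrow> (inv\<^bsub>gen_series_ring V m\<^esub> S) i [] j = C $$ (i, j)"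
proof -
  interpret ring "gen_series_ring V m" by (rule ring_gen_series_ring)
  obtain T where T: "T \<in> carrier (gen_series_ring V m)" "S \<otimes>\<^bsub>gen_series_ring V m\<^esub> T = \<one>\<^bsub>gen_series_ring V m\<^esub>"
    "\<And>i j. i < m \<Longrightarrow> j < m \<Longrightarrow> T i [] j = C $$ (i, j)"
    using exists_right_inverse_series[OF S B C BC SB] by blast
  obtain U where U: "U \<in> carrier (gen_series_ring V m)" "T \<otimes>\<^bsub>gen_series_ring V m\<^esub> U = \<one>\<^bsub>gen_series_ring V m\<^esub>"
    using exists_right_inverse_series[OF T(1) C B CB T(3)] by blast
  have "S = S \<otimes>\<^bsub>gen_series_ring V m\<^esub> (T \<otimes>\<^bsub>gen_series_ring V m\<^esub> U)"
    using S U by simp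
  also have "\<dots> = (S \<otimes>\<^bsub>gen_series_ring V m\<^esub> T) \<otimes>\<^bsub>gen_series_ring V m\<^esub> U"
    using m_assoc[OF S T(1) U(1)] by simp
  also have "\<dots> = U"
    using T(2) U(1) by simp
  finally have TS: "T \<otimes>\<^bsub>gen_series_ring V m\<^esub> S = \<one>\<^bsub>gen_series_ring V m\<^esub>"
    using U by simp
  show "S \<in> Units (gen_series_ring V m)"
    using S T TS unfolding Units_def by blast
  have "inv\<^bsub>gen_series_ring V m\<^esub> S = T"
    using inv_unique'[OF S T(1,2) TS] by simp
  then show "i < m \<Longrightarrow> j < m \<Longrightarrow> (inv\<^bsub>gen_series_ring V m\<^esub> S) i [] j = C $$ (i, j)"
    using T(3) by simp
qed


section \<open>Evaluating a generalized series on a line through an amplified point\<close>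

lemma block_index_less: "q < m \<Longrightarrow> s < L \<Longrightarrow> q * L + s < m * (L::nat)"
proof -
  assume "q < m" "s < L"
  then have "q * L + s < Suc q * L" by simp
  also have "\<dots> \<le> m * L" using \<open>q < m\<close> by (intro mult_right_mono) auto
  finally show ?thesis .
qed

lemma sum_block_index:
  fixes L :: nat
  shows "(\<Sum>K<m * L. g (K div L) (K mod L)) = (\<Sum>q<m. \<Sum>s<L. g q s)"
proof (cases "L = 0")
  case False
  have "(\<Sum>K<m * L. g (K div L) (K mod L)) = (\<Sum>(q, s)\<in>{..<m} \<times> {..<L}. g q s)"
    by (rule sum.reindex_bij_witness[where i = "\<lambda>(q, s). q * L + s" and j = "\<lambda>K. (K div L, K mod L)"])
      (use False in \<open>auto simp: block_index_less less_mult_imp_div_less\<close>)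
  then show ?thesis
    by (simp add: sum.cartesian_product)
qed simp

text \<open>The Kronecker product of \<open>M\<close> with the identity matrix of size \<open>L\<close>.\<close>

definition amplify :: "nat \<Rightarrow> 'k::zero mat \<Rightarrow> 'k mat" where
  "amplify L M = mat (dim_row M * L) (dim_col M * L)
     (\<lambda>(I, J). if I mod L = J mod L then M $$ (I div L, J div L) else 0)"

lemma amplify_carrier: "M \<in> carrier_mat n n \<Longrightarrow> amplify L M \<in> carrier_mat (n * L) (n * L)"
  by (auto simp: amplify_def)

lemma amplify_index:
  assumes "M \<in> carrier_mat n n" "I < n * L" "J < n * L"
  shows "amplify L M $$ (I, J) = (if I mod L = J mod L then M $$ (I div L, J div L) else 0)"
  using assms by (auto simp: amplify_def)

lemma amplify_inj:
  assumes M: "M \<in> carrier_mat n n" "M' \<in> carrier_mat n n" and L: "L > 0" and eq: "amplify L M = amplify L M'"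
  shows "M = M'"
proof (rule eq_matI)
  fix i j assume "i < dim_row M'" "j < dim_col M'"
  then have ij: "i < n" "j < n" using M by auto
  then have "i * L < n * L" "j * L < n * L" using L by auto
  then show "M $$ (i, j) = M' $$ (i, j)"
    using amplify_index[OF M(1), of "i * L" L "j * L"] amplify_index[OF M(2), of "i * L" L "j * L"] eq L
    by simp
qed (use M in auto)

text \<open>
  Let \<open>Y (x, a, b)\<close> be the blocks, of size \<open>L\<close>, of a matrix substituted for the letter \<open>x\<close>. As
  \<open>E i a \<cdot> x \<cdot> E b j\<close> then has the block \<open>Y (x, a, b)\<close> at the position \<open>(i, j)\<close> and no other, the
  blocks of a series are ordinary noncommutative series in the blocks of the letters. They are
  power series in the variable \<open>t\<close> once the letters are replaced by their \<open>t\<close>-fold.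
\<close>

definition series_mat ::
    "'x set \<Rightarrow> nat \<Rightarrow> nat \<Rightarrow> ('x \<times> nat \<times> nat \<Rightarrow> nat \<Rightarrow> nat \<Rightarrow> 'k::field) \<Rightarrow> ('x, 'k) gen_series \<Rightarrow> 'k fps mat" where
  "series_mat V m L Y S = mat (m * L) (m * L) (\<lambda>(I, J). Abs_fps (\<lambda>h.
     \<Sum>\<omega>\<in>words_over (V \<times> {..<m} \<times> {..<m}) h.
       S (I div L) \<omega> (J div L) * path_prod L Y \<omega> (I mod L) (J mod L)))"

lemma series_mat_carrier [simp]: "series_mat V m L Y S \<in> carrier_mat (m * L) (m * L)"
  "dim_row (series_mat V m L Y S) = m * L" "dim_col (series_mat V m L Y S) = m * L"
  by (simp_all add: series_mat_def)

lemma series_mat_nth: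
  assumes "I < m * L" "J < m * L"
  shows "fps_nth (series_mat V m L Y S $$ (I, J)) h = (\<Sum>\<omega>\<in>words_over (V \<times> {..<m} \<times> {..<m}) h.
       S (I div L) \<omega> (J div L) * path_prod L Y \<omega> (I mod L) (J mod L))"
  using assms by (simp add: series_mat_def)

lemma series_mat_eqI:
  assumes "M \<in> carrier_mat (m * L) (m * L)"
    and "\<And>I J h. I < m * L \<Longrightarrow> J < m * L \<Longrightarrow> fps_nth (M $$ (I, J)) h =
      (\<Sum>\<omega>\<in>words_over (V \<times> {..<m} \<times> {..<m}) h. S (I div L) \<omega> (J div L) * path_prod L Y \<omega> (I mod L) (J mod L))"
  shows "series_mat V m L Y S = M"
  by (rule eq_matI) (use assms in \<open>auto simp: series_mat_nth fps_eq_iff\<close>)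

lemma series_mat_add:
  "series_mat V m L Y (S \<oplus>\<^bsub>gen_series_ring V m\<^esub> T) = series_mat V m L Y S + series_mat V m L Y T"
  by (rule series_mat_eqI)
    (auto simp: series_mat_nth gen_series_ring_simps ring_distribs sum.distrib intro!: add_carrier_mat)

lemma series_mat_zero: "series_mat V m L Y (\<lambda>i \<omega> j. 0) = 0\<^sub>m (m * L) (m * L)"
  by (rule series_mat_eqI) auto

lemma series_mat_const:
  fixes V :: "'x::finite set"
  assumes M: "M \<in> carrier_mat m m"
  shows "series_mat V m L Y (const_series m M) = map_mat fps_const (amplify L M)"
proof (rule series_mat_eqI)
  fix I J h assume I: "I < m * L" and J: "J < m * L"
  have "h \<noteq> 0 \<Longrightarrow> \<omega> \<in> words_over (V \<times> {..<m} \<times> {..<m}) h \<Longrightarrow> const_series m M (I div L) \<omega> (J div L) = 0" for \<omega>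
    by (auto simp: const_series_def words_over_def)
  then show "fps_nth (map_mat fps_const (amplify L M) $$ (I, J)) h =
      (\<Sum>\<omega>\<in>words_over (V \<times> {..<m} \<times> {..<m}) h.
        const_series m M (I div L) \<omega> (J div L) * path_prod L Y \<omega> (I mod L) (J mod L))"
    using I J amplify_carrier[OF M, of L]
    by (cases "h = 0") (auto simp: amplify_index[OF M] const_series_def less_mult_imp_div_less)
qed (use amplify_carrier[OF M, of L] in simp)

lemma amplify_one: "amplify L (1\<^sub>m m) = 1\<^sub>m (m * L)"
proof (rule eq_matI)
  fix I J assume IJ: "I < dim_row (1\<^sub>m (m * L))" "J < dim_col (1\<^sub>m (m * L))"
  have "I = J \<longleftrightarrow> I div L = J div L \<and> I mod L = J mod L"
    by (metis div_mult_mod_eq)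
  then show "amplify L (1\<^sub>m m) $$ (I, J) = 1\<^sub>m (m * L) $$ (I, J)"
    using IJ by (auto simp: amplify_index[OF one_carrier_mat] less_mult_imp_div_less)
qed (auto simp: amplify_def)

lemma series_mat_one:
  fixes V :: "'x::finite set"
  shows "series_mat V m L Y \<one>\<^bsub>gen_series_ring V m\<^esub> = 1\<^sub>m (m * L)"
proof -
  have "\<one>\<^bsub>gen_series_ring V m\<^esub> = (const_series m (1\<^sub>m m) :: ('x, 'a::field) gen_series)"
    by (auto simp: gen_series_ring_simps const_series_def fun_eq_iff)
  then show ?thesis
    by (simp add: series_mat_const amplify_one) (auto intro!: eq_matI)
qed

lemma series_mat_letter:
  fixes V :: "'x::finite set"
  assumes "x \<in> V"
  shows "series_mat V m L Y (letter_series m x) = mat (m * L) (m * L)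
    (\<lambda>(I, J). fps_X * fps_const (Y (x, I div L, J div L) (I mod L) (J mod L)))"
proof (rule series_mat_eqI)
  fix I J h assume I: "I < m * L" and J: "J < m * L"
  have L: "L > 0" using I by (cases L) auto
  have ij: "I div L < m" "J div L < m" using I J by (auto simp: less_mult_imp_div_less)
  let ?f = "\<lambda>\<omega>. letter_series m x (I div L) \<omega> (J div L) * path_prod L Y \<omega> (I mod L) (J mod L)"
  have "(\<Sum>\<omega>\<in>words_over (V \<times> {..<m} \<times> {..<m}) h. ?f \<omega>) =
    (\<Sum>\<omega>\<in>words_over (V \<times> {..<m} \<times> {..<m}) h. if \<omega> = [(x, I div L, J div L)] then ?f \<omega> else 0)"
    by (rule sum.cong) (auto simp: letter_series_def)
  also have "\<dots> = (if h = 1 then ?f [(x, I div L, J div L)] else 0)"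
    using ij assms by (subst sum.delta) (auto simp: finite_words_over, auto simp: words_over_def)
  also have "?f [(x, I div L, J div L)] = (\<Sum>q<L. if q = J mod L then Y (x, I div L, J div L) (I mod L) q else 0)"
    using ij by (simp add: letter_series_def if_distrib cong: if_cong)
  also have "\<dots> = Y (x, I div L, J div L) (I mod L) (J mod L)"
    using L by simp
  finally show "fps_nth (mat (m * L) (m * L)
      (\<lambda>(I, J). fps_X * fps_const (Y (x, I div L, J div L) (I mod L) (J mod L))) $$ (I, J)) h =
    (\<Sum>\<omega>\<in>words_over (V \<times> {..<m} \<times> {..<m}) h. ?f \<omega>)"
    using I J by simp
qed simp

lemma series_mat_mult:
  fixes V :: "'x::finite set"
  shows "series_mat V m L Y (S \<otimes>\<^bsub>gen_series_ring V m\<^esub> T) = series_mat V m L Y S * series_mat V m L Y T"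
proof (rule series_mat_eqI)
  fix I J h assume I: "I < m * L" and J: "J < m * L"
  define i r j s where ij: "i = I div L" "r = I mod L" "j = J div L" "s = J mod L"
  have r: "r < L" using I unfolding ij by (cases L) auto
  let ?W = "words_over (V \<times> {..<m} \<times> {..<m})"
  let ?f = "\<lambda>p q s'. \<Sum>\<omega>\<in>?W p. S i \<omega> q * path_prod L Y \<omega> r s'"
  let ?g = "\<lambda>p q s'. \<Sum>\<omega>\<in>?W (h - p). T q \<omega> j * path_prod L Y \<omega> s' s"
  have "fps_nth ((series_mat V m L Y S * series_mat V m L Y T) $$ (I, J)) h =
    (\<Sum>K<m * L. \<Sum>p\<le>h. ?f p (K div L) (K mod L) * ?g p (K div L) (K mod L))"
    using I J by (simp add: scalar_prod_def fps_sum_nth fps_mult_nth series_mat_nth ij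
        lessThan_atLeast0 atMost_atLeast0)
  also have "\<dots> = (\<Sum>p\<le>h. \<Sum>K<m * L. ?f p (K div L) (K mod L) * ?g p (K div L) (K mod L))"
    by (rule sum.swap)
  also have "\<dots> = (\<Sum>p\<le>h. \<Sum>q<m. \<Sum>s'<L. ?f p q s' * ?g p q s')"
    by (intro sum.cong refl sum_block_index)
  also have "\<dots> = (\<Sum>p\<le>h. \<Sum>\<omega>\<in>?W h. \<Sum>q<m. S i (take p \<omega>) q * T q (drop p \<omega>) j * path_prod L Y \<omega> r s)"
  proof (rule sum.cong[OF refl])
    fix p assume "p \<in> {..h}"
    then have p: "p \<le> h" by simp
    have "(\<Sum>q<m. \<Sum>s'<L. ?f p q s' * ?g p q s') = (\<Sum>q<m. \<Sum>s'<L. \<Sum>\<omega>\<in>?W p. \<Sum>\<omega>'\<in>?W (h - p).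
        S i \<omega> q * path_prod L Y \<omega> r s' * (T q \<omega>' j * path_prod L Y \<omega>' s' s))"
      by (simp only: sum_product)
    also have "\<dots> = (\<Sum>q<m. \<Sum>s'<L. \<Sum>\<omega>\<in>?W h. S i (take p \<omega>) q * path_prod L Y (take p \<omega>) r s' *
        (T q (drop p \<omega>) j * path_prod L Y (drop p \<omega>) s' s))"
      by (simp only: sum_words_over_split[OF p, symmetric])
    also have "\<dots> = (\<Sum>q<m. \<Sum>\<omega>\<in>?W h. \<Sum>s'<L. S i (take p \<omega>) q * path_prod L Y (take p \<omega>) r s' *
        (T q (drop p \<omega>) j * path_prod L Y (drop p \<omega>) s' s))"
      by (intro sum.cong refl sum.swap)
    also have "\<dots> = (\<Sum>q<m. \<Sum>\<omega>\<in>?W h. S i (take p \<omega>) q * T q (drop p \<omega>) j * path_prod L Y \<omega> r s)"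
    proof (intro sum.cong refl)
      fix q \<omega>
      show "(\<Sum>s'<L. S i (take p \<omega>) q * path_prod L Y (take p \<omega>) r s' *
        (T q (drop p \<omega>) j * path_prod L Y (drop p \<omega>) s' s)) =
        S i (take p \<omega>) q * T q (drop p \<omega>) j * path_prod L Y \<omega> r s"
        using path_prod_append[OF r, of Y "take p \<omega>" "drop p \<omega>" s] by (simp add: sum_distrib_left mult_ac)
    qed
    also have "\<dots> = (\<Sum>\<omega>\<in>?W h. \<Sum>q<m. S i (take p \<omega>) q * T q (drop p \<omega>) j * path_prod L Y \<omega> r s)"
      by (rule sum.swap)
    finally show "(\<Sum>q<m. \<Sum>s'<L. ?f p q s' * ?g p q s') = \<dots>" .
  qed
  also have "\<dots> = (\<Sum>\<omega>\<in>?W h. \<Sum>p\<le>h. \<Sum>q<m. S i (take p \<omega>) q * T q (drop p \<omega>) j * path_prod L Y \<omega> r s)"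
    by (rule sum.swap)
  also have "\<dots> = (\<Sum>\<omega>\<in>?W h. (S \<otimes>\<^bsub>gen_series_ring V m\<^esub> T) i \<omega> j * path_prod L Y \<omega> r s)"
    by (rule sum.cong) (auto simp: words_over_def gen_series_mult sum_distrib_right)
  finally show "fps_nth ((series_mat V m L Y S * series_mat V m L Y T) $$ (I, J)) h =
    (\<Sum>\<omega>\<in>?W h. (S \<otimes>\<^bsub>gen_series_ring V m\<^esub> T) (I div L) \<omega> (J div L) * path_prod L Y \<omega> (I mod L) (J mod L))"
    unfolding ij .
qed (rule mult_carrier_mat[of _ _ "m * L"]; simp)


section \<open>Series of finite shift dimension\<close>

interpretation word_fun: vector_space "\<lambda>(a::'k::field) (g::'y list \<Rightarrow> nat \<Rightarrow> 'k) \<omega> j. a * g \<omega> j"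
  by unfold_locales (auto simp: fun_eq_iff algebra_simps)

definition shift :: "'y \<Rightarrow> ('y list \<Rightarrow> nat \<Rightarrow> 'k) \<Rightarrow> 'y list \<Rightarrow> nat \<Rightarrow> 'k" where
  "shift y g = (\<lambda>\<omega>. g (y # \<omega>))"

text \<open>
  The coordinate-free form of a linear representation over the field: the span of \<open>G\<close> is the
  space of states, and a letter acts on it by the shift. Only this is kept of a realization. A
  realization of dimension \<open>d\<close> over the \<open>m \<times> m\<close> matrices gives \<open>D = d * m\<close>.
\<close>

definition shift_dim_le ::
    "nat \<Rightarrow> (nat \<Rightarrow> 'y list \<Rightarrow> nat \<Rightarrow> 'k::field) \<Rightarrow> nat \<Rightarrow> bool" where
  "shift_dim_le m S D \<longleftrightarrow> (\<exists>G. finite G \<and> card G \<le> D \<and>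
     (\<forall>g\<in>G. \<forall>y. shift y g \<in> word_fun.span G) \<and> (\<forall>i<m. S i \<in> word_fun.span G))"

lemma sum_fun_apply2: "(\<Sum>a\<in>K. F a) \<omega> j = (\<Sum>a\<in>K. F a \<omega> j)"
  by (induction K rule: infinite_finite_induct) auto

lemma word_fun_span_combination:
  assumes "\<And>\<omega> j. g \<omega> j = (\<Sum>a\<in>K. \<alpha> a * F a \<omega> j)" and "\<And>a. a \<in> K \<Longrightarrow> F a \<in> word_fun.span G"
  shows "g \<in> word_fun.span G"
proof -
  have "g = (\<Sum>a\<in>K. (\<lambda>\<omega> j. \<alpha> a * F a \<omega> j))"
    using assms(1) by (intro ext) (simp add: sum_fun_apply2)
  then show ?thesis
    using assms(2) by (auto intro: word_fun.span_sum word_fun.span_scale)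
qed

lemma word_fun_span_combination2:
  assumes "\<And>\<omega> j. g \<omega> j = (\<Sum>a\<in>K. \<Sum>b\<in>K'. \<alpha> a b * F a b \<omega> j)"
    and "\<And>a b. a \<in> K \<Longrightarrow> b \<in> K' \<Longrightarrow> F a b \<in> word_fun.span G"
  shows "g \<in> word_fun.span G"
proof -
  define H where "H a \<omega> j = (\<Sum>b\<in>K'. \<alpha> a b * F a b \<omega> j)" for a \<omega> j
  have H: "H a \<in> word_fun.span G" if "a \<in> K" for a
    by (rule word_fun_span_combination[where K = K' and \<alpha> = "\<alpha> a" and F = "F a"])
      (simp_all add: H_def assms(2) that)
  show ?thesis
    by (rule word_fun_span_combination[where \<alpha> = "\<lambda>a. 1" and K = K and F = H])
      (simp_all add: assms(1) H_def[symmetric] H)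
qed

lemma shift_mem_span:
  fixes G H :: "('y list \<Rightarrow> nat \<Rightarrow> 'k::field) set"
  assumes "\<And>g. g \<in> G \<Longrightarrow> shift y g \<in> word_fun.span H" and "g \<in> word_fun.span G"
  shows "shift y g \<in> word_fun.span H"
  using assms(2)
proof (rule word_fun.span_induct)
  have "shift y (g + h) = shift y g + shift y h" "shift y (0 :: 'y list \<Rightarrow> nat \<Rightarrow> 'k) = 0"
    "shift y (\<lambda>\<omega> j. a * g \<omega> j) = (\<lambda>\<omega> j. a * shift y g \<omega> j)"
    for g h :: "'y list \<Rightarrow> nat \<Rightarrow> 'k" and a
    by (auto simp: shift_def fun_eq_iff)
  then show "word_fun.subspace {g. shift y g \<in> word_fun.span H}"
    by (auto simp: word_fun.subspace_def intro: word_fun.span_add word_fun.span_scale word_fun.span_zero)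
qed (use assms(1) in auto)

lemma shift_dim_le_mono: "shift_dim_le m S D \<Longrightarrow> D \<le> D' \<Longrightarrow> shift_dim_le m S D'"
  unfolding shift_dim_le_def by (meson le_trans)

text \<open>
  Let \<open>K h\<close> be the space of the states that vanish on all words shorter than \<open>h\<close>. The spaces
  decrease, and once two consecutive ones agree, they stay the same because a shift maps
  \<open>K (h + 1)\<close> into \<open>K h\<close>. As long as they are different, elements of the differences
  are linearly independent, so that the sequence is constant from \<open>K D\<close> on.
\<close>

lemma zero_if_zero_on_short_words:
  fixes S :: "nat \<Rightarrow> 'y list \<Rightarrow> nat \<Rightarrow> 'k::field"
  assumes S: "shift_dim_le m S D"
    and short: "\<And>i \<omega> j. i < m \<Longrightarrow> length \<omega> < D \<Longrightarrow> S i \<omega> j = 0"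
    and i: "i < m"
  shows "S i \<omega> j = 0"
proof -
  obtain G where G: "finite G" "card G \<le> D" "\<And>g y. g \<in> G \<Longrightarrow> shift y g \<in> word_fun.span G"
    "\<And>i. i < m \<Longrightarrow> S i \<in> word_fun.span G"
    using S unfolding shift_dim_le_def by blast
  define K where "K h = {g \<in> word_fun.span G. \<forall>\<omega> j. length \<omega> < h \<longrightarrow> g \<omega> j = 0}" for h
  have sub: "word_fun.subspace (K h)" for h
    unfolding K_def word_fun.subspace_def
    by (auto intro: word_fun.span_add word_fun.span_scale word_fun.span_zero)
  have anti: "K h' \<subseteq> K h" if "h \<le> h'" for h h'
    using that unfolding K_def by auto
  have shiftK: "shift y g \<in> K h" if "g \<in> K (Suc h)" for g y h
    using that shift_mem_span[of G y G g] G(3) unfolding K_def shift_def by auto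
  have step: "K (Suc h) \<subseteq> K (Suc (Suc h))" if st: "K h \<subseteq> K (Suc h)" for h
  proof
    fix g assume g: "g \<in> K (Suc h)"
    have "g \<omega> j = 0" if "length \<omega> < Suc (Suc h)" for \<omega> j
    proof (cases \<omega>)
      case (Cons y \<omega>')
      have "shift y g \<in> K (Suc h)"
        using shiftK[OF g] st by blast
      then show ?thesis
        using that Cons by (auto simp: K_def shift_def)
    qed (use g in \<open>auto simp: K_def\<close>)
    then show "g \<in> K (Suc (Suc h))"
      using g by (auto simp: K_def)
  qed
  have "\<exists>h\<le>D. K h \<subseteq> K (Suc h)"
  proof (rule ccontr)
    assume "\<not> ?thesis"
    then have "\<forall>h\<in>{..D}. \<exists>g. g \<in> K h \<and> g \<notin> K (Suc h)"
      by auto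
    then obtain v where v: "\<And>h. h \<le> D \<Longrightarrow> v h \<in> K h \<and> v h \<notin> K (Suc h)"
      by (metis atMost_iff)
    \<comment> \<open>The vectors are added from the last one on: the later ones lie in \<open>K (Suc h)\<close>, \<open>v h\<close> does not.\<close>
    have ind: "word_fun.independent (v ` {h..<Suc D}) \<and> card (v ` {h..<Suc D}) = Suc D - h"
      if "h \<le> Suc D" for h
      using that
    proof (induction h rule: inc_induct)
      case base
      then show ?case by (simp add: word_fun.independent_empty)
    next
      case (step h)
      have "v ` {Suc h..<Suc D} \<subseteq> K (Suc h)"
      proof
        fix g assume "g \<in> v ` {Suc h..<Suc D}"
        then obtain l where "Suc h \<le> l" "l \<le> D" "g = v l" by auto
        then show "g \<in> K (Suc h)" using v[of l] anti[of "Suc h" l] by blast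
      qed
      then have "word_fun.span (v ` {Suc h..<Suc D}) \<subseteq> K (Suc h)"
        by (rule word_fun.span_minimal) (rule sub)
      then have notin: "v h \<notin> word_fun.span (v ` {Suc h..<Suc D})"
        using v[of h] step.hyps by auto
      moreover have "{h..<Suc D} = insert h {Suc h..<Suc D}"
        using step.hyps by auto
      then have "v ` {h..<Suc D} = insert (v h) (v ` {Suc h..<Suc D})"
        by simp
      moreover have "v h \<notin> v ` {Suc h..<Suc D}"
        using notin word_fun.span_base by blast
      ultimately show ?case
        using step.IH step.hyps by (simp add: word_fun.independent_insertI)
    qed
    have "v ` {0..<Suc D} \<subseteq> word_fun.span G"
      using v unfolding K_def by auto
    then have "card (v ` {0..<Suc D}) \<le> card G"
      using word_fun.independent_span_bound[OF G(1)] ind[of 0] by blast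
    then show False
      using ind[of 0] G(2) by simp
  qed
  then obtain h where h: "h \<le> D" "K h \<subseteq> K (Suc h)" by blast
  have "K h \<subseteq> K (h + l) \<and> K (h + l) \<subseteq> K (Suc (h + l))" for l
    by (induction l) (use h step in auto)
  then have "S i \<in> K (h + Suc (length \<omega>))"
    using G(4)[OF i] short[OF i] anti[OF h(1)] unfolding K_def by blast
  then show ?thesis
    unfolding K_def by auto
qed


subsection \<open>Closure properties\<close>

lemma shift_dim_le_add:
  assumes "shift_dim_le m S D" "shift_dim_le m T D'"
  shows "shift_dim_le m (\<lambda>i \<omega> j. S i \<omega> j + T i \<omega> j) (D + D')"
proof -
  obtain G where G: "finite G" "card G \<le> D" "\<forall>g\<in>G. \<forall>y. shift y g \<in> word_fun.span G"
    "\<forall>i<m. S i \<in> word_fun.span G"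
    using assms unfolding shift_dim_le_def by blast
  obtain H where H: "finite H" "card H \<le> D'" "\<forall>g\<in>H. \<forall>y. shift y g \<in> word_fun.span H"
    "\<forall>i<m. T i \<in> word_fun.span H"
    using assms unfolding shift_dim_le_def by blast
  have sp: "word_fun.span G \<subseteq> word_fun.span (G \<union> H)" "word_fun.span H \<subseteq> word_fun.span (G \<union> H)"
    by (auto intro!: word_fun.span_mono)
  have "(\<lambda>\<omega> j. S i \<omega> j + T i \<omega> j) \<in> word_fun.span (G \<union> H)" if "i < m" for i
    using word_fun.span_add[of "S i" "G \<union> H" "T i"] that G(4) H(4) sp by (auto simp: plus_fun_def)
  then show ?thesis
    unfolding shift_dim_le_def using G H sp card_Un_le[of G H]
    by (intro exI[of _ "G \<union> H"]) auto
qed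

lemma shift_dim_le_zero: "shift_dim_le m (\<lambda>i \<omega> j. 0) 0"
  unfolding shift_dim_le_def
  by (intro exI[of _ "{}"]) (auto simp: fun_eq_iff)

definition right_mult ::
    "nat \<Rightarrow> ('x, 'k::field) gen_series \<Rightarrow> (('x \<times> nat \<times> nat) list \<Rightarrow> nat \<Rightarrow> 'k) \<Rightarrow>
      ('x \<times> nat \<times> nat) list \<Rightarrow> nat \<Rightarrow> 'k" where
  "right_mult m T g = (\<lambda>\<omega> j. \<Sum>p\<le>length \<omega>. \<Sum>q<m. g (take p \<omega>) q * T q (drop p \<omega>) j)"

lemma shift_right_mult:
  "shift y (right_mult m T g) \<omega> j = (\<Sum>q<m. g [] q * shift y (T q) \<omega> j) + right_mult m T (shift y g) \<omega> j"
  by (simp add: shift_def right_mult_def sum.atMost_Suc_shift del: sum.atMost_Suc)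

lemma right_mult_mem_span:
  assumes "g \<in> word_fun.span G"
  shows "right_mult m T g \<in> word_fun.span (right_mult m T ` G)"
  using assms
proof (rule word_fun.span_induct)
  have "right_mult m T (g + h) = right_mult m T g + right_mult m T h" "right_mult m T 0 = 0"
    "right_mult m T (\<lambda>\<omega> j. a * g \<omega> j) = (\<lambda>\<omega> j. a * right_mult m T g \<omega> j)" for g h a
    by (auto simp: right_mult_def fun_eq_iff sum_distrib_left algebra_simps sum.distrib)
  then show "word_fun.subspace {g. right_mult m T g \<in> word_fun.span (right_mult m T ` G)}"
    by (auto simp: word_fun.subspace_def intro: word_fun.span_add word_fun.span_scale word_fun.span_zero)
qed (auto intro: word_fun.span_base)

text \<open>
  The shift of a product of a state \<open>g\<close> with \<open>T\<close> consists of the product of a shift of \<open>g\<close> with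
  \<open>T\<close> and of a combination of shifts of \<open>T\<close>, so that the dimensions add.
\<close>

lemma shift_dim_le_mult:
  assumes "shift_dim_le m S D" "shift_dim_le m T D'"
  shows "shift_dim_le m (S \<otimes>\<^bsub>gen_series_ring V m\<^esub> T) (D + D')"
proof -
  obtain G where G: "finite G" "card G \<le> D" "\<forall>g\<in>G. \<forall>y. shift y g \<in> word_fun.span G"
    "\<forall>i<m. S i \<in> word_fun.span G"
    using assms unfolding shift_dim_le_def by blast
  obtain H where H: "finite H" "card H \<le> D'" "\<forall>g\<in>H. \<forall>y. shift y g \<in> word_fun.span H"
    "\<forall>i<m. T i \<in> word_fun.span H"
    using assms unfolding shift_dim_le_def by blast
  let ?G = "right_mult m T ` G \<union> H"
  have sp: "word_fun.span (right_mult m T ` G) \<subseteq> word_fun.span ?G" "word_fun.span H \<subseteq> word_fun.span ?G"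
    by (auto intro!: word_fun.span_mono)
  have "shift y (right_mult m T g) \<in> word_fun.span ?G" if "g \<in> G" for g y
  proof -
    have 1: "(\<lambda>\<omega> j. \<Sum>q<m. g [] q * shift y (T q) \<omega> j) \<in> word_fun.span ?G"
    proof (rule word_fun_span_combination[OF refl])
      fix q assume "q \<in> {..<m}"
      then have Tq: "T q \<in> word_fun.span H"
        using H(4) by simp
      have "shift y (T q) \<in> word_fun.span H"
        by (rule shift_mem_span[OF _ Tq]) (rule H(3)[rule_format])
      then show "shift y (T q) \<in> word_fun.span ?G"
        using sp(2) by blast
    qed
    have 2: "right_mult m T (shift y g) \<in> word_fun.span ?G"
      using right_mult_mem_span[of "shift y g" G m T] G(3) that sp(1) by blast
    have "shift y (right_mult m T g) =
      (\<lambda>\<omega> j. \<Sum>q<m. g [] q * shift y (T q) \<omega> j) + right_mult m T (shift y g)"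
      by (intro ext) (simp add: shift_right_mult)
    then show ?thesis
      using word_fun.span_add[OF 1 2] by simp
  qed
  moreover have "(S \<otimes>\<^bsub>gen_series_ring V m\<^esub> T) i \<in> word_fun.span ?G" if "i < m" for i
  proof -
    have "(S \<otimes>\<^bsub>gen_series_ring V m\<^esub> T) i = right_mult m T (S i)"
      by (intro ext) (simp add: gen_series_mult right_mult_def)
    then show ?thesis
      using right_mult_mem_span[of "S i" G m T] G(4) that sp(1) by auto
  qed
  moreover have "card ?G \<le> D + D'"
    using card_Un_le[of "right_mult m T ` G" H] card_image_le[OF G(1), of "right_mult m T"] G(2) H(2)
    by linarith
  ultimately show ?thesis
    unfolding shift_dim_le_def using G(1) H sp(2) by (intro exI[of _ ?G]) auto
qed

text \<open>
  The states remain the same, as a constant on the left only replaces the initial states by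
  combinations of them. So the coefficients of a polynomial do not add to the dimension.
\<close>

lemma shift_dim_le_left_const:
  assumes "shift_dim_le m S D" "\<And>i \<omega> q. \<omega> \<noteq> [] \<Longrightarrow> C i \<omega> q = 0"
  shows "shift_dim_le m (C \<otimes>\<^bsub>gen_series_ring V m\<^esub> S) D"
proof -
  obtain G where G: "finite G" "card G \<le> D" "\<forall>g\<in>G. \<forall>y. shift y g \<in> word_fun.span G"
    "\<forall>i<m. S i \<in> word_fun.span G"
    using assms unfolding shift_dim_le_def by blast
  have "(C \<otimes>\<^bsub>gen_series_ring V m\<^esub> S) i \<in> word_fun.span G" for i
  proof (rule word_fun_span_combination)
    show "(C \<otimes>\<^bsub>gen_series_ring V m\<^esub> S) i \<omega> j = (\<Sum>q<m. C i [] q * S q \<omega> j)" for \<omega> j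
      using assms(2) by (rule gen_series_mult_left_const)
  qed (use G(4) in auto)
  then show ?thesis
    unfolding shift_dim_le_def using G by blast
qed

lemma shift_dim_le_const:
  fixes C :: "nat \<Rightarrow> 'y list \<Rightarrow> nat \<Rightarrow> 'k::field"
  assumes "\<And>i \<omega> q. \<omega> \<noteq> [] \<Longrightarrow> C i \<omega> q = 0" "\<And>i \<omega> j. C i \<omega> j \<noteq> 0 \<Longrightarrow> j < m"
  shows "shift_dim_le m C m"
proof -
  let ?e = "\<lambda>q (\<omega>::'y list) (j::nat). if \<omega> = [] \<and> j = q then 1 else 0 :: 'k"
  have "shift y (?e q) = 0" for y q
    by (auto simp: shift_def fun_eq_iff)
  moreover have "C i \<in> word_fun.span (?e ` {..<m})" for i
  proof (rule word_fun_span_combination)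
    fix \<omega> j
    have "(\<Sum>q<m. C i [] q * ?e q \<omega> j) = (\<Sum>q<m. if q = j then if \<omega> = [] then C i [] j else 0 else 0)"
      by (rule sum.cong) auto
    moreover have "C i \<omega> j = 0" if "\<not> j < m"
      using assms(2) that by blast
    ultimately show "C i \<omega> j = (\<Sum>q<m. C i [] q * ?e q \<omega> j)"
      using assms(1) by (cases "\<omega> = []") auto
  qed (auto intro: word_fun.span_base)
  moreover have "card (?e ` {..<m}) \<le> m"
    using card_image_le[of "{..<m}" ?e] by simp
  ultimately show ?thesis
    unfolding shift_dim_le_def by (intro exI[of _ "?e ` {..<m}"]) (auto simp: word_fun.span_zero)
qed

text \<open>
  A row of the series \<open>x + M\<close> becomes a unit vector, or zero, when a letter is read, and then
  zero. So the \<open>m\<close> rows and the \<open>m\<close> unit vectors suffice.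
\<close>

lemma shift_dim_le_letter:
  fixes M :: "'k::field mat" and x :: 'x
  assumes M: "M \<in> carrier_mat m m"
  shows "shift_dim_le m (\<lambda>i \<omega> j. letter_series m x i \<omega> j + const_series m M i \<omega> j) (2 * m)"
    (is "shift_dim_le m ?S _")
proof -
  let ?e = "\<lambda>q (\<omega>::('x \<times> nat \<times> nat) list) (j::nat). if \<omega> = [] \<and> j = q then 1 else 0 :: 'k"
  let ?G = "?e ` {..<m} \<union> ?S ` {..<m}"
  have e: "shift y (?e q) = 0" for y q
    by (auto simp: shift_def fun_eq_iff)
  have S: "shift y (?S i) \<in> word_fun.span ?G" if "i < m" for i and y :: "'x \<times> nat \<times> nat"
  proof (cases "\<exists>b<m. y = (x, i, b)")
    case True
    then obtain b where "b < m" "y = (x, i, b)" by blast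
    then have "shift y (?S i) = ?e b"
      using that by (auto simp: shift_def letter_series_def const_series_def fun_eq_iff)
    then show ?thesis
      using \<open>b < m\<close> by (auto intro!: word_fun.span_base)
  next
    case False
    then have "shift y (?S i) = 0"
      by (auto simp: shift_def letter_series_def const_series_def fun_eq_iff)
    then show ?thesis by (simp add: word_fun.span_zero)
  qed
  have "card ?G \<le> 2 * m"
    using card_Un_le[of "?e ` {..<m}" "?S ` {..<m}"] card_image_le[of "{..<m}" ?e] card_image_le[of "{..<m}" ?S]
    by simp
  then show ?thesis
    unfolding shift_dim_le_def using e S
    by (intro exI[of _ ?G]) (auto simp: word_fun.span_zero intro: word_fun.span_base)
qed


subsection \<open>Realizations\<close>

lemma word_bimoduleD:
  assumes "S \<in> word_bimodule V m w"
  shows "S \<in> carrier (gen_series_ring V m)" and "map fst \<omega> \<noteq> w \<Longrightarrow> S i \<omega> j = 0"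
proof -
  show "S \<in> carrier (gen_series_ring V m)"
    using assms by (simp add: word_bimodule_def)
  have "S i \<omega> j = word_component w S i \<omega> j"
    using assms by (simp add: word_bimodule_def)
  then show "map fst \<omega> \<noteq> w \<Longrightarrow> S i \<omega> j = 0"
    by (simp add: word_component_def)
qed

text \<open>
  The states are the rows of the series that the representation would have with another initial
  vector; a letter \<open>(x, a, b)\<close> reads the coefficient at \<open>E a b\<close> of the matrix of \<open>x\<close>.
\<close>

lemma shift_dim_le_realization:
  fixes V :: "'x::finite set" and S :: "('x, 'k::field) gen_series"
  assumes lin: "linear_representation V m d c A b" and rep: "represents V m d c A b S"
    and S: "S \<in> carrier (gen_series_ring V m)"
  shows "shift_dim_le m S (d * m)"
proof -
  let ?R = "gen_series_ring V m :: ('x, 'k) gen_series ring"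
  interpret R: ring ?R by (rule ring_gen_series_ring)
  have c: "c p \<in> carrier ?R" "\<And>i \<omega> q. \<omega> \<noteq> [] \<Longrightarrow> c p i \<omega> q = 0" if "p < d" for p
    using lin that word_bimoduleD[of "c p" V m "[]"] unfolding linear_representation_def by auto
  have b: "b p \<in> carrier ?R" "\<And>i \<omega> q. \<omega> \<noteq> [] \<Longrightarrow> b p i \<omega> q = 0" if "p < d" for p
    using lin that word_bimoduleD[of "b p" V m "[]"] unfolding linear_representation_def by auto
  have A: "A x p l \<in> carrier ?R" "\<And>i \<omega> q. map fst \<omega> \<noteq> [x] \<Longrightarrow> A x p l i \<omega> q = 0"
    if "x \<in> V" "p < d" "l < d" for x p l
    using lin that word_bimoduleD[of "A x p l" V m "[x]"] unfolding linear_representation_def by auto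
  define W where "W w = word_matrix ?R d A w" for w
  have W: "W w p l \<in> carrier ?R" if "set w \<subseteq> V" "p < d" "l < d" for w p l
    using that
  proof (induction w arbitrary: p)
    case (Cons x w)
    then show ?case
      using A(1) unfolding W_def by (auto intro!: R.finsum_closed)
  qed (auto simp: W_def)
  define g where "g p i \<omega> j = (if fst ` set \<omega> \<subseteq> V
    then \<Sum>l<d. \<Sum>q<m. W (map fst \<omega>) p l i \<omega> q * b l q [] j else 0)" for p i \<omega> j
  let ?G = "(\<lambda>(p, i). g p i) ` ({..<d} \<times> {..<m})"
  have "shift y (g p i) \<in> word_fun.span ?G" if p: "p < d" for p i y
  proof -
    obtain x a e where y: "y = (x, a, e)" by (cases y)
    show ?thesis
    proof (cases "x \<in> V")
      case False
      then have "shift y (g p i) = 0"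
        by (auto simp: shift_def g_def y fun_eq_iff)
      then show ?thesis by (simp add: word_fun.span_zero)
    next
      case x: True
      show ?thesis
      proof (rule word_fun_span_combination2)
        fix \<omega> j
        show "shift y (g p i) \<omega> j = (\<Sum>l'<d. \<Sum>q'<m. A x p l' i [y] q' * g l' q' \<omega> j)"
        proof (cases "fst ` set \<omega> \<subseteq> V")
          case True
          let ?w = "map fst \<omega>"
          have AW: "(A x p l' \<otimes>\<^bsub>?R\<^esub> W ?w l' l) i (y # \<omega>) q = (\<Sum>q'<m. A x p l' i [y] q' * W ?w l' l q' \<omega> q)"
            if "l' < d" for l' l q
          proof -
            have "(\<lambda>i \<omega>. A x p l' i (y # \<omega>)) i \<omega>' q = 0" if "\<omega>' \<noteq> []" for \<omega>' q
              using A(2)[OF x p \<open>l' < d\<close>, of "y # \<omega>'" i q] that by simp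
            then show ?thesis
              unfolding gen_series_mult_Cons using A(2)[OF x p \<open>l' < d\<close>, of "[]" i]
              by (simp add: gen_series_mult_left_const)
          qed
          have Wx: "W (x # ?w) p l i (y # \<omega>) q = (\<Sum>l'<d. \<Sum>q'<m. A x p l' i [y] q' * W ?w l' l q' \<omega> q)"
            if "l < d" for l q
          proof -
            have "W (x # ?w) p l = (\<Oplus>\<^bsub>?R\<^esub>l'\<in>{..<d}. A x p l' \<otimes>\<^bsub>?R\<^esub> W ?w l' l)"
              by (simp add: W_def)
            also have "\<dots> = (\<lambda>i \<omega> j. \<Sum>l'<d. (A x p l' \<otimes>\<^bsub>?R\<^esub> W ?w l' l) i \<omega> j)"
              using A(1)[OF x p] W[OF _ _ that] True by (intro gen_series_finsum) (auto intro!: R.m_closed)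
            finally show ?thesis
              by (simp add: AW)
          qed
          have "shift y (g p i) \<omega> j = (\<Sum>l<d. \<Sum>q<m. W (x # ?w) p l i (y # \<omega>) q * b l q [] j)"
            using x True by (simp add: shift_def g_def y)
          also have "\<dots> = (\<Sum>l<d. \<Sum>q<m. \<Sum>l'<d. \<Sum>q'<m. A x p l' i [y] q' * W ?w l' l q' \<omega> q * b l q [] j)"
            by (simp add: Wx sum_distrib_right)
          also have "\<dots> = (\<Sum>l<d. \<Sum>l'<d. \<Sum>q<m. \<Sum>q'<m. A x p l' i [y] q' * W ?w l' l q' \<omega> q * b l q [] j)"
            by (intro sum.cong refl sum.swap)
          also have "\<dots> = (\<Sum>l'<d. \<Sum>l<d. \<Sum>q<m. \<Sum>q'<m. A x p l' i [y] q' * W ?w l' l q' \<omega> q * b l q [] j)"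
            by (rule sum.swap)
          also have "\<dots> = (\<Sum>l'<d. \<Sum>l<d. \<Sum>q'<m. \<Sum>q<m. A x p l' i [y] q' * W ?w l' l q' \<omega> q * b l q [] j)"
            by (intro sum.cong refl sum.swap)
          also have "\<dots> = (\<Sum>l'<d. \<Sum>q'<m. \<Sum>l<d. \<Sum>q<m. A x p l' i [y] q' * W ?w l' l q' \<omega> q * b l q [] j)"
            by (intro sum.cong refl sum.swap)
          also have "\<dots> = (\<Sum>l'<d. \<Sum>q'<m. A x p l' i [y] q' * g l' q' \<omega> j)"
            using True by (simp add: g_def sum_distrib_left mult.assoc)
          finally show ?thesis .
        qed (simp add: shift_def g_def)
      qed (auto intro: word_fun.span_base)
    qed
  qed
  moreover have "S i \<in> word_fun.span ?G" if "i < m" for i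
  proof (rule word_fun_span_combination2)
    fix \<omega> j
    show "S i \<omega> j = (\<Sum>p<d. \<Sum>q<m. c p i [] q * g p q \<omega> j)"
    proof (cases "fst ` set \<omega> \<subseteq> V")
      case False
      then have "S i \<omega> j = 0"
        using S unfolding mem_gen_series_ring by fastforce
      then show ?thesis
        using False by (simp add: g_def)
    next
      case True
      let ?w = "map fst \<omega>"
      have cW: "c p \<otimes>\<^bsub>?R\<^esub> W ?w p l \<in> carrier ?R" if "p < d" "l < d" for p l
        using c(1) W that True by (intro R.m_closed) auto
      have cWb: "c p \<otimes>\<^bsub>?R\<^esub> W ?w p l \<otimes>\<^bsub>?R\<^esub> b l \<in> carrier ?R" if "p < d" "l < d" for p l
        by (rule R.m_closed[OF cW[OF that] b(1)[OF that(2)]])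
      have "S i \<omega> j = word_component ?w S i \<omega> j"
        by (simp add: word_component_def)
      also have "word_component ?w S = (\<Oplus>\<^bsub>?R\<^esub>p\<in>{..<d}. \<Oplus>\<^bsub>?R\<^esub>l\<in>{..<d}. c p \<otimes>\<^bsub>?R\<^esub> W ?w p l \<otimes>\<^bsub>?R\<^esub> b l)"
        using rep True unfolding represents_def Let_def W_def by (simp add: lists_eq_set)
      also have "\<dots> = (\<lambda>i \<omega> j. \<Sum>p<d. (\<Oplus>\<^bsub>?R\<^esub>l\<in>{..<d}. c p \<otimes>\<^bsub>?R\<^esub> W ?w p l \<otimes>\<^bsub>?R\<^esub> b l) i \<omega> j)"
        using cWb by (intro gen_series_finsum) (auto intro!: R.finsum_closed)
      also have "\<dots> i \<omega> j = (\<Sum>p<d. \<Sum>l<d. (c p \<otimes>\<^bsub>?R\<^esub> W ?w p l \<otimes>\<^bsub>?R\<^esub> b l) i \<omega> j)"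
        using cWb by (intro sum.cong refl) (subst gen_series_finsum, auto)
      also have "\<dots> = (\<Sum>p<d. \<Sum>l<d. \<Sum>q<m. (\<Sum>q'<m. c p i [] q' * W ?w p l q' \<omega> q) * b l q [] j)"
        by (intro sum.cong refl) (simp add: gen_series_mult_right_const gen_series_mult_left_const b(2) c(2))
      also have "\<dots> = (\<Sum>p<d. \<Sum>l<d. \<Sum>q'<m. \<Sum>q<m. c p i [] q' * W ?w p l q' \<omega> q * b l q [] j)"
        unfolding sum_distrib_right by (intro sum.cong refl sum.swap)
      also have "\<dots> = (\<Sum>p<d. \<Sum>q'<m. \<Sum>l<d. \<Sum>q<m. c p i [] q' * W ?w p l q' \<omega> q * b l q [] j)"
        by (intro sum.cong refl sum.swap)
      also have "\<dots> = (\<Sum>p<d. \<Sum>q'<m. c p i [] q' * g p q' \<omega> j)"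
        using True by (simp add: g_def sum_distrib_left mult.assoc)
      finally show ?thesis .
    qed
  qed (auto intro: word_fun.span_base)
  moreover have "card ?G \<le> d * m"
    using card_image_le[of "{..<d} \<times> {..<m}" "\<lambda>(p, i). g p i"] by (simp add: card_cartesian_product)
  ultimately show ?thesis
    unfolding shift_dim_le_def by (intro exI[of _ ?G]) auto
qed


section \<open>Rational expressions on a line through an amplified point\<close>

interpretation poly_at: comm_ring_hom "\<lambda>p::'k::field poly. poly p t" for t
  by unfold_locales auto

interpretation fps_of_poly: comm_ring_hom "fps_of_poly :: 'k::field poly \<Rightarrow> 'k fps"
  by unfold_locales (auto simp: fps_of_poly_add fps_of_poly_mult)

lemma pointsD:
  assumes "(m, P) \<in> points V"
  shows "m \<ge> 1" and "x \<in> V \<Longrightarrow> P x \<in> carrier_mat m m"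
  using assms by (auto simp: points_def points_of_size_def)

lemma word_eval_Nil [simp]: "word_eval n A [] = 1\<^sub>m n"
  and word_eval_Cons [simp]: "word_eval n A (x # w) = A x * word_eval n A w"
  by (simp_all add: word_eval_def)

lemma word_eval_carrier:
  assumes "\<And>x. x \<in> set w \<Longrightarrow> A x \<in> carrier_mat n n"
  shows "word_eval n A w \<in> carrier_mat n n"
  using assms
proof (induction w)
  case (Cons x w)
  then show ?case
    using mult_carrier_mat[of "A x" n n "word_eval n A w" n] by simp
qed simp

lemma (in semiring_hom) map_mat_word_eval:
  assumes "\<And>x. x \<in> set w \<Longrightarrow> A x \<in> carrier_mat n n" "\<And>x. x \<in> set w \<Longrightarrow> B x = map_mat hom (A x)"
  shows "map_mat hom (word_eval n A w) = word_eval n B w"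
  using assms
proof (induction w)
  case (Cons x w)
  have "map_mat hom (word_eval n A (x # w)) = map_mat hom (A x) * map_mat hom (word_eval n A w)"
    unfolding word_eval_Cons by (rule mat_hom_mult[of _ n n _ n]) (use Cons.prems word_eval_carrier[of w A n] in auto)
  then show ?case
    using Cons by simp
qed (simp add: mat_hom_one)

definition line_letter ::
    "nat \<Rightarrow> nat \<Rightarrow> ('x \<Rightarrow> 'k::field mat) \<Rightarrow> ('x \<times> nat \<times> nat \<Rightarrow> nat \<Rightarrow> nat \<Rightarrow> 'k) \<Rightarrow> 'x \<Rightarrow> 'k poly mat" where
  "line_letter m L P Y x = mat (m * L) (m * L) (\<lambda>(I, J).
     [: amplify L (P x) $$ (I, J), Y (x, I div L, J div L) (I mod L) (J mod L) :])"

definition line_point ::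
    "'x set \<Rightarrow> nat \<Rightarrow> nat \<Rightarrow> ('x \<Rightarrow> 'k::field mat) \<Rightarrow> ('x \<times> nat \<times> nat \<Rightarrow> nat \<Rightarrow> nat \<Rightarrow> 'k) \<Rightarrow> 'k \<Rightarrow> ('x, 'k) point" where
  "line_point V m L P Y t = (m * L, \<lambda>x\<in>V. map_mat (\<lambda>p. poly p t) (line_letter m L P Y x))"

lemma line_letter_carrier [simp]: "line_letter m L P Y x \<in> carrier_mat (m * L) (m * L)"
  by (simp add: line_letter_def)

definition line_nc_eval ::
    "nat \<Rightarrow> nat \<Rightarrow> ('x \<Rightarrow> 'k::field mat) \<Rightarrow> ('x \<times> nat \<times> nat \<Rightarrow> nat \<Rightarrow> nat \<Rightarrow> 'k) \<Rightarrow> ('x, 'k) nc_poly \<Rightarrow> 'k poly mat" where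
  "line_nc_eval m L P Y f = mat (m * L) (m * L) (\<lambda>ij. \<Sum>w\<in>Poly_Mapping.keys f.
     [: Poly_Mapping.lookup f w :] * word_eval (m * L) (line_letter m L P Y) (letters w) $$ ij)"

lemma line_nc_eval_carrier [simp]: "line_nc_eval m L P Y f \<in> carrier_mat (m * L) (m * L)"
  by (simp add: line_nc_eval_def)

lemma nc_eval_line_point:
  assumes "f \<in> nc_polys_over V"
  shows "nc_eval (line_point V m L P Y t) f = map_mat (\<lambda>p. poly p t) (line_nc_eval m L P Y f)"
proof (rule eq_matI)
  let ?B = "\<lambda>x\<in>V. map_mat (\<lambda>p. poly p t) (line_letter m L P Y x)"
  fix I J assume "I < dim_row (map_mat (\<lambda>p. poly p t) (line_nc_eval m L P Y f))"
    "J < dim_col (map_mat (\<lambda>p. poly p t) (line_nc_eval m L P Y f))"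
  then have IJ: "I < m * L" "J < m * L" by (simp_all add: line_nc_eval_def)
  have "word_eval (m * L) ?B (letters w) $$ (I, J) =
    poly (word_eval (m * L) (line_letter m L P Y) (letters w) $$ (I, J)) t"
    if "w \<in> Poly_Mapping.keys f" for w
  proof -
    have "map_mat (\<lambda>p. poly p t) (word_eval (m * L) (line_letter m L P Y) (letters w)) =
      word_eval (m * L) ?B (letters w)"
      using assms that by (intro poly_at.map_mat_word_eval) (auto simp: nc_polys_over_def)
    then show ?thesis
      using IJ word_eval_carrier[of "letters w" "line_letter m L P Y" "m * L"]
      by (metis carrier_matD(1) carrier_matD(2) index_map_mat(1) line_letter_carrier)
  qed
  then show "nc_eval (line_point V m L P Y t) f $$ (I, J) =
    map_mat (\<lambda>p. poly p t) (line_nc_eval m L P Y f) $$ (I, J)"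
    using IJ by (simp add: nc_eval_def line_point_def line_nc_eval_def poly_sum)
qed (simp_all add: nc_eval_def line_point_def line_nc_eval_def)


subsection \<open>The expansion of a polynomial\<close>

definition word_expand :: "'x set \<Rightarrow> nat \<Rightarrow> ('x \<Rightarrow> 'k::field mat) \<Rightarrow> 'x list \<Rightarrow> ('x, 'k) gen_series" where
  "word_expand V m P w = foldr (\<lambda>x S. (letter_series m x \<oplus>\<^bsub>gen_series_ring V m\<^esub> const_series m (P x))
     \<otimes>\<^bsub>gen_series_ring V m\<^esub> S) w \<one>\<^bsub>gen_series_ring V m\<^esub>"

lemma word_expand_simps:
  "word_expand V m P [] = \<one>\<^bsub>gen_series_ring V m\<^esub>"
  "word_expand V m P (x # w) = (letter_series m x \<oplus>\<^bsub>gen_series_ring V m\<^esub> const_series m (P x))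
     \<otimes>\<^bsub>gen_series_ring V m\<^esub> word_expand V m P w"
  by (simp_all add: word_expand_def)

lemma word_expand_carrier:
  assumes "set w \<subseteq> V"
  shows "word_expand V m P w \<in> carrier (gen_series_ring V m)"
proof -
  interpret ring "gen_series_ring V m" by (rule ring_gen_series_ring)
  show ?thesis
    using assms by (induction w)
      (auto simp: word_expand_simps intro!: m_closed a_closed letter_series_carrier const_series_carrier)
qed

lemma nc_expand_eq:
  assumes "f \<in> nc_polys_over V"
  shows "nc_expand V (m, P) f = (\<lambda>i \<omega> j. \<Sum>w\<in>Poly_Mapping.keys f.
      (const_series m (Poly_Mapping.lookup f w \<cdot>\<^sub>m 1\<^sub>m m) \<otimes>\<^bsub>gen_series_ring V m\<^esub>
        word_expand V m P (letters w)) i \<omega> j)"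
    and "nc_expand V (m, P) f \<in> carrier (gen_series_ring V m)"
proof -
  interpret ring "gen_series_ring V m" by (rule ring_gen_series_ring)
  have carrier: "const_series m (Poly_Mapping.lookup f w \<cdot>\<^sub>m 1\<^sub>m m) \<otimes>\<^bsub>gen_series_ring V m\<^esub>
        word_expand V m P (letters w) \<in> carrier (gen_series_ring V m)"
    if "w \<in> Poly_Mapping.keys f" for w
    using assms that
    by (intro m_closed const_series_carrier word_expand_carrier) (auto simp: nc_polys_over_def)
  show "nc_expand V (m, P) f = (\<lambda>i \<omega> j. \<Sum>w\<in>Poly_Mapping.keys f.
      (const_series m (Poly_Mapping.lookup f w \<cdot>\<^sub>m 1\<^sub>m m) \<otimes>\<^bsub>gen_series_ring V m\<^esub>
        word_expand V m P (letters w)) i \<omega> j)"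
    and "nc_expand V (m, P) f \<in> carrier (gen_series_ring V m)"
    using gen_series_finsum[OF finite_keys carrier]
    by (simp_all add: nc_expand_def Let_def word_expand_def)
qed

lemma const_series_scalar_mult:
  fixes S :: "('x, 'k::field) gen_series"
  assumes "S \<in> carrier (gen_series_ring V m)"
  shows "(const_series m (c \<cdot>\<^sub>m 1\<^sub>m m) \<otimes>\<^bsub>gen_series_ring V m\<^esub> S) i \<omega> j = c * S i \<omega> j"
proof -
  let ?C = "const_series m (c \<cdot>\<^sub>m 1\<^sub>m m) :: ('x, 'k) gen_series"
  have "(?C \<otimes>\<^bsub>gen_series_ring V m\<^esub> S) i \<omega> j = (\<Sum>q<m. ?C i [] q * S q \<omega> j)"
    by (rule gen_series_mult_left_const) (simp add: const_series_def)
  also have "\<dots> = c * S i \<omega> j"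
  proof (cases "i < m")
    case True
    then have "(\<Sum>q<m. ?C i [] q * S q \<omega> j) = (\<Sum>q<m. if q = i then c * S q \<omega> j else 0)"
      by (intro sum.cong) (auto simp: const_series_def)
    then show ?thesis using True by simp
  next
    case False
    then have "S i \<omega> j = 0" using assms by (auto simp: mem_gen_series_ring)
    then show ?thesis using False by (simp add: const_series_def)
  qed
  finally show ?thesis .
qed

lemma nc_expand_eq_sum:
  assumes "f \<in> nc_polys_over V"
  shows "nc_expand V (m, P) f = (\<lambda>i \<omega> j. \<Sum>w\<in>Poly_Mapping.keys f.
      Poly_Mapping.lookup f w * word_expand V m P (letters w) i \<omega> j)"
  unfolding nc_expand_eq(1)[OF assms] using assms
  by (intro ext sum.cong refl const_series_scalar_mult word_expand_carrier) (auto simp: nc_polys_over_def)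

lemma word_expand_const_term:
  assumes "\<And>x. x \<in> set w \<Longrightarrow> P x \<in> carrier_mat m m" "i < m" "j < m"
  shows "word_expand V m P w i [] j = word_eval m P w $$ (i, j)"
  using assms
proof (induction w arbitrary: i)
  case (Cons x w)
  have P: "P x \<in> carrier_mat m m" "word_eval m P w \<in> carrier_mat m m"
    using Cons.prems word_eval_carrier[of w P m] by auto
  have "word_expand V m P (x # w) i [] j = (\<Sum>q<m. P x $$ (i, q) * word_eval m P w $$ (q, j))"
    unfolding word_expand_simps gen_series_mult_Nil using Cons
    by (intro sum.cong refl) (simp add: gen_series_ring_simps letter_series_def const_series_def)
  also have "\<dots> = word_eval m P (x # w) $$ (i, j)"
    using P Cons.prems(2,3) by (simp add: scalar_prod_def lessThan_atLeast0)
  finally show ?case .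
qed (simp add: word_expand_simps gen_series_ring_simps)

lemma series_mat_word_expand:
  fixes V :: "'x::finite set"
  assumes "set w \<subseteq> V" "\<And>x. x \<in> set w \<Longrightarrow> P x \<in> carrier_mat m m"
  shows "series_mat V m L Y (word_expand V m P w) =
    map_mat fps_of_poly (word_eval (m * L) (line_letter m L P Y) w)"
  using assms
proof (induction w)
  case Nil
  then show ?case
    by (simp add: word_expand_simps series_mat_one fps_of_poly.mat_hom_one)
next
  case (Cons x w)
  have x: "x \<in> V" "P x \<in> carrier_mat m m" using Cons.prems by auto
  have "series_mat V m L Y (letter_series m x \<oplus>\<^bsub>gen_series_ring V m\<^esub> const_series m (P x)) =
    map_mat fps_of_poly (line_letter m L P Y x)"
    unfolding series_mat_add series_mat_letter[OF x(1)] series_mat_const[OF x(2)]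
    by (rule eq_matI)
      (use amplify_carrier[OF x(2), of L] in \<open>auto simp: line_letter_def fps_of_poly_pCons mult.commute add.commute\<close>)
  moreover have "map_mat fps_of_poly (line_letter m L P Y x * word_eval (m * L) (line_letter m L P Y) w) =
    map_mat fps_of_poly (line_letter m L P Y x) * map_mat fps_of_poly (word_eval (m * L) (line_letter m L P Y) w)"
    by (rule fps_of_poly.mat_hom_mult[of _ "m * L" "m * L" _ "m * L"]) (auto intro!: word_eval_carrier)
  ultimately show ?case
    using Cons by (simp add: word_expand_simps series_mat_mult)
qed

lemma series_mat_nc_expand:
  fixes V :: "'x::finite set"
  assumes f: "f \<in> nc_polys_over V" and P: "\<And>x. x \<in> V \<Longrightarrow> P x \<in> carrier_mat m m"
  shows "series_mat V m L Y (nc_expand V (m, P) f) = map_mat fps_of_poly (line_nc_eval m L P Y f)"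
proof (rule series_mat_eqI)
  fix I J h assume IJ: "I < m * L" "J < m * L"
  let ?W = "words_over (V \<times> {..<m} \<times> {..<m}) h"
  let ?E = "\<lambda>w. word_eval (m * L) (line_letter m L P Y) (letters w) $$ (I, J)"
  have "fps_nth (fps_of_poly (?E w)) h = (\<Sum>\<omega>\<in>?W. word_expand V m P (letters w) (I div L) \<omega> (J div L)
      * path_prod L Y \<omega> (I mod L) (J mod L))" if "w \<in> Poly_Mapping.keys f" for w
  proof -
    have w: "set (letters w) \<subseteq> V" using f that by (auto simp: nc_polys_over_def)
    have "word_eval (m * L) (line_letter m L P Y) (letters w) \<in> carrier_mat (m * L) (m * L)"
      by (rule word_eval_carrier) simp
    then have "fps_of_poly (?E w) = series_mat V m L Y (word_expand V m P (letters w)) $$ (I, J)"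
      using series_mat_word_expand[OF w P, where L = L and Y = Y] w IJ by (simp add: subset_iff)
    then show ?thesis
      by (simp add: series_mat_nth[OF IJ])
  qed
  then have "(\<Sum>w\<in>Poly_Mapping.keys f. Poly_Mapping.lookup f w * fps_nth (fps_of_poly (?E w)) h) =
    (\<Sum>w\<in>Poly_Mapping.keys f. \<Sum>\<omega>\<in>?W. Poly_Mapping.lookup f w *
      (word_expand V m P (letters w) (I div L) \<omega> (J div L) * path_prod L Y \<omega> (I mod L) (J mod L)))"
    by (intro sum.cong refl) (simp add: sum_distrib_left)
  also have "\<dots> = (\<Sum>\<omega>\<in>?W. nc_expand V (m, P) f (I div L) \<omega> (J div L) * path_prod L Y \<omega> (I mod L) (J mod L))"
    by (subst sum.swap) (simp add: nc_expand_eq_sum[OF f] sum_distrib_right mult.assoc)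
  finally show "fps_nth (map_mat fps_of_poly (line_nc_eval m L P Y f) $$ (I, J)) h =
    (\<Sum>\<omega>\<in>?W. nc_expand V (m, P) f (I div L) \<omega> (J div L) * path_prod L Y \<omega> (I mod L) (J mod L))"
    using IJ by (simp add: line_nc_eval_def coeff_sum)
qed simp


subsection \<open>Inverses\<close>

lemma mat_inverse_eq_Some:
  fixes A :: "'k::field mat"
  assumes A: "A \<in> carrier_mat n n" and B: "B \<in> carrier_mat n n" and AB: "A * B = 1\<^sub>m n"
  shows "mat_inverse A = Some B"
proof (cases "mat_inverse A")
  case None
  have "det A \<noteq> 0"
    using det_mult[OF A B] AB by auto
  then show ?thesis
    using mat_inverse(1)[OF A None, where b = "()"] det_non_zero_imp_unit[OF A, where b = "()"] by simp
next
  case (Some C)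
  then have C: "C * A = 1\<^sub>m n" "C \<in> carrier_mat n n"
    using mat_inverse(2)[OF A] by auto
  have "C = C * (A * B)"
    using C AB by simp
  also have "\<dots> = (C * A) * B"
    using assoc_mult_mat[OF C(2) A B] by simp
  also have "\<dots> = B"
    using C B by simp
  finally show ?thesis
    using Some by simp
qed

lemma mat_inverse_eq_None:
  fixes A :: "'k::field mat"
  assumes A: "A \<in> carrier_mat n n" and "det A = 0"
  shows "mat_inverse A = None"
proof (cases "mat_inverse A")
  case (Some B)
  then have "A * B = 1\<^sub>m n" "B \<in> carrier_mat n n"
    using mat_inverse(2)[OF A] by auto
  then have "det A * det B = 1"
    using det_mult[OF A, of B] by simp
  then show ?thesis
    using assms by simp
qed

text \<open>
  The constant term of the expansion at \<open>P\<close> is the value at \<open>P\<close>. So an inverse that exists at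
  \<open>P\<close> also exists in the ring of the generalized series, and the expansion of its expression is
  a genuine inverse.
\<close>

lemma rat_expand_at_point:
  fixes V :: "'x::finite set"
  assumes pt: "(m, P) \<in> points V"
    and "polys s \<subseteq> nc_polys_over V" "rat_eval (m, P) s = Some B"
  shows "B \<in> carrier_mat m m" and "rat_expand V (m, P) s \<in> carrier (gen_series_ring V m)"
    and "i < m \<Longrightarrow> j < m \<Longrightarrow> rat_expand V (m, P) s i [] j = B $$ (i, j)"
proof -
  interpret ring "gen_series_ring V m" by (rule ring_gen_series_ring)
  note P = pointsD(2)[OF pt]
  have "B \<in> carrier_mat m m \<and> rat_expand V (m, P) s \<in> carrier (gen_series_ring V m) \<and>
    (\<forall>i<m. \<forall>j<m. rat_expand V (m, P) s i [] j = B $$ (i, j))"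
    using assms(2,3)
  proof (induction s arbitrary: B)
    case (Pol f)
    then have f: "f \<in> nc_polys_over V" and B: "B = nc_eval (m, P) f" by auto
    have "word_expand V m P (letters w) i [] j = word_eval m P (letters w) $$ (i, j)"
      if "w \<in> Poly_Mapping.keys f" "i < m" "j < m" for w i j
      using word_expand_const_term[of "letters w" P m i j V] P f that by (auto simp: nc_polys_over_def)
    then show ?case
      using nc_expand_eq(2)[OF f, of m P] unfolding B by (auto simp: nc_eval_def nc_expand_eq_sum[OF f])
  next
    case (Add s t)
    then obtain S T where ST: "rat_eval (m, P) s = Some S" "rat_eval (m, P) t = Some T" "B = S + T"
      by (auto simp: bind_eq_Some_conv)
    have "polys s \<subseteq> nc_polys_over V" "polys t \<subseteq> nc_polys_over V"
      using Add.prems by auto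
    note IH = Add.IH(1)[OF this(1) ST(1)] Add.IH(2)[OF this(2) ST(2)]
    then have "rat_expand V (m, P) (Add s t) \<in> carrier (gen_series_ring V m)"
      by simp
    then show ?case
      using IH ST(3) by (auto simp: gen_series_ring_simps)
  next
    case (Mul s t)
    then obtain S T where ST: "rat_eval (m, P) s = Some S" "rat_eval (m, P) t = Some T" "B = S * T"
      by (auto simp: bind_eq_Some_conv)
    have "polys s \<subseteq> nc_polys_over V" "polys t \<subseteq> nc_polys_over V"
      using Mul.prems by auto
    note IH = Mul.IH(1)[OF this(1) ST(1)] Mul.IH(2)[OF this(2) ST(2)]
    then have "rat_expand V (m, P) (Mul s t) \<in> carrier (gen_series_ring V m)"
      by simp
    then show ?case
      using IH ST(3) by (auto simp: gen_series_mult_Nil scalar_prod_def lessThan_atLeast0)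
  next
    case (Inv s)
    then obtain S where S: "rat_eval (m, P) s = Some S" "mat_inverse S = Some B"
      by (auto simp: bind_eq_Some_conv)
    have IH: "S \<in> carrier_mat m m" "rat_expand V (m, P) s \<in> carrier (gen_series_ring V m)"
      "\<And>i j. i < m \<Longrightarrow> j < m \<Longrightarrow> rat_expand V (m, P) s i [] j = S $$ (i, j)"
      using Inv.IH[OF _ S(1)] Inv.prems by auto
    have B: "S * B = 1\<^sub>m m" "B * S = 1\<^sub>m m" "B \<in> carrier_mat m m"
      using mat_inverse(2)[OF IH(1) S(2)] by auto
    show ?case
      using gen_series_unit[OF IH(2,1) B(3,1,2) IH(3)] B(3) by simp
  qed
  then show "B \<in> carrier_mat m m" "rat_expand V (m, P) s \<in> carrier (gen_series_ring V m)"
    "i < m \<Longrightarrow> j < m \<Longrightarrow> rat_expand V (m, P) s i [] j = B $$ (i, j)"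
    by auto
qed

lemma rat_expand_unit:
  fixes V :: "'x::finite set"
  assumes pt: "(m, P) \<in> points V"
    and s: "polys s \<subseteq> nc_polys_over V" and def: "rat_eval (m, P) (Inv s) \<noteq> None"
  shows "rat_expand V (m, P) s \<in> Units (gen_series_ring V m)"
proof -
  obtain S B where S: "rat_eval (m, P) s = Some S" "mat_inverse S = Some B"
    using def by (auto simp: bind_eq_None_conv)
  note at = rat_expand_at_point[OF pt s S(1)]
  have "S * B = 1\<^sub>m m" "B * S = 1\<^sub>m m" "B \<in> carrier_mat m m"
    using mat_inverse(2)[OF at(1) S(2)] by auto
  then show ?thesis
    using gen_series_unit(1)[OF at(2,1)] at(3) by blast
qed


subsection \<open>Expressions as matrices over the rational functions of one variable\<close>

text \<open>
  The common denominator \<open>d\<close> is chosen to vanish exactly where the expression is undefined.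
  This replaces the evaluation over the field of rational functions.
\<close>

definition represents_on_line ::
    "('x, 'k) nc_rat_expr \<Rightarrow> nat \<Rightarrow> ('k \<Rightarrow> ('x, 'k::field) point) \<Rightarrow> 'k poly \<Rightarrow> 'k poly mat \<Rightarrow> bool" where
  "represents_on_line s n l d M \<longleftrightarrow> M \<in> carrier_mat n n \<and> (\<forall>t. rat_eval (l t) s =
     (if poly d t = 0 then None else Some (inverse (poly d t) \<cdot>\<^sub>m map_mat (\<lambda>p. poly p t) M)))"

lemma represents_on_lineD:
  assumes "represents_on_line s n l d M" "poly d t \<noteq> 0"
  shows "rat_eval (l t) s = Some (inverse (poly d t) \<cdot>\<^sub>m map_mat (\<lambda>p. poly p t) M)"
  using assms by (simp add: represents_on_line_def)

lemma represents_on_line_Add: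
  assumes "represents_on_line s n l d M" "represents_on_line s' n l d' M'"
  shows "represents_on_line (Add s s') n l (d * d') (d' \<cdot>\<^sub>m M + d \<cdot>\<^sub>m M')"
proof -
  have M: "M \<in> carrier_mat n n" "M' \<in> carrier_mat n n"
    using assms by (auto simp: represents_on_line_def)
  have "inverse (poly d t) \<cdot>\<^sub>m map_mat (\<lambda>p. poly p t) M + inverse (poly d' t) \<cdot>\<^sub>m map_mat (\<lambda>p. poly p t) M' =
    inverse (poly (d * d') t) \<cdot>\<^sub>m map_mat (\<lambda>p. poly p t) (d' \<cdot>\<^sub>m M + d \<cdot>\<^sub>m M')"
    if "poly d t \<noteq> 0" "poly d' t \<noteq> 0" for t
    by (rule eq_matI) (use M that in \<open>auto simp: field_simps\<close>)
  then show ?thesis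
    using assms M unfolding represents_on_line_def by auto
qed

lemma represents_on_line_Mul:
  assumes "represents_on_line s n l d M" "represents_on_line s' n l d' M'"
  shows "represents_on_line (Mul s s') n l (d * d') (M * M')"
proof -
  have M: "M \<in> carrier_mat n n" "M' \<in> carrier_mat n n"
    using assms by (auto simp: represents_on_line_def)
  have "(inverse (poly d t) \<cdot>\<^sub>m map_mat (\<lambda>p. poly p t) M) * (inverse (poly d' t) \<cdot>\<^sub>m map_mat (\<lambda>p. poly p t) M') =
    inverse (poly (d * d') t) \<cdot>\<^sub>m map_mat (\<lambda>p. poly p t) (M * M')" for t
    unfolding poly_at.mat_hom_mult[OF M]
    by (rule eq_matI) (use M in \<open>auto simp: scalar_prod_def sum_distrib_left mult_ac\<close>)
  then show ?thesis
    using assms M unfolding represents_on_line_def by auto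
qed

lemma represents_on_line_Inv:
  assumes "represents_on_line s n l d M"
  shows "represents_on_line (Inv s) n l (d * det M) (d ^ 2 \<cdot>\<^sub>m adj_mat M)"
proof -
  have M: "M \<in> carrier_mat n n"
    using assms by (auto simp: represents_on_line_def)
  note adj = adj_mat[OF M]
  have "rat_eval (l t) (Inv s) = (if poly (d * det M) t = 0 then None
    else Some (inverse (poly (d * det M) t) \<cdot>\<^sub>m map_mat (\<lambda>p. poly p t) (d ^ 2 \<cdot>\<^sub>m adj_mat M)))" for t
  proof (cases "poly d t = 0")
    case True
    then show ?thesis
      using assms by (simp add: represents_on_line_def)
  next
    case d: False
    let ?h = "map_mat (\<lambda>p. poly p t)"
    let ?A = "inverse (poly d t) \<cdot>\<^sub>m ?h M"
    have A: "?A \<in> carrier_mat n n" using M by simp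
    have eval: "rat_eval (l t) (Inv s) = mat_inverse ?A"
      using assms d by (simp add: represents_on_line_def)
    show ?thesis
    proof (cases "poly (det M) t = 0")
      case True
      then have "det ?A = 0"
        by (simp add: poly_at.hom_det)
      then show ?thesis
        using mat_inverse_eq_None[OF A] eval True by simp
    next
      case False
      let ?B = "inverse (poly (d * det M) t) \<cdot>\<^sub>m ?h (d ^ 2 \<cdot>\<^sub>m adj_mat M)"
      have B: "?B = (poly d t * inverse (poly (det M) t)) \<cdot>\<^sub>m ?h (adj_mat M)"
        by (rule eq_matI) (use d False adj(1) in \<open>auto simp: field_simps power2_eq_square\<close>)
      have hM: "?h M \<in> carrier_mat n n" "?h (adj_mat M) \<in> carrier_mat n n"
        using M adj(1) by auto
      have "?h M * ?h (adj_mat M) = poly (det M) t \<cdot>\<^sub>m 1\<^sub>m n"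
      proof -
        have "?h M * ?h (adj_mat M) = ?h (M * adj_mat M)"
          using poly_at.mat_hom_mult[OF M adj(1)] by simp
        also have "\<dots> = poly (det M) t \<cdot>\<^sub>m 1\<^sub>m n"
          unfolding adj(2) by (rule eq_matI) auto
        finally show ?thesis .
      qed
      then have AB: "?A * ?B = 1\<^sub>m n"
        unfolding B mult_smult_distrib[OF smult_carrier_mat[OF hM(1)] hM(2)] mult_smult_assoc_mat[OF hM]
        by (intro eq_matI) (use d False in \<open>auto simp: field_simps\<close>)
      then show ?thesis
        using mat_inverse_eq_Some[OF A _ AB] eval d False adj(1) by auto
    qed
  qed
  then show ?thesis
    using adj(1) unfolding represents_on_line_def by auto
qed

text \<open>
  On the line \<open>t \<mapsto> P \<otimes> 1 + t Y\<close> an expression is a rational function of \<open>t\<close>. If it is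
  defined at \<open>P\<close>, its expansion at \<open>t = 0\<close> is read off from the series that the expression
  has at \<open>P\<close>.
\<close>

lemma rat_expr_on_line:
  fixes V :: "'x::finite set" and P :: "'x \<Rightarrow> 'k::field mat"
  assumes pt: "(m, P) \<in> points V" and "polys s \<subseteq> nc_polys_over V"
  shows "\<exists>d M. represents_on_line s (m * L) (line_point V m L P Y) d M \<and>
    (rat_eval (m, P) s \<noteq> None \<longrightarrow> poly d 0 \<noteq> 0 \<and>
      map_mat fps_of_poly M = fps_of_poly d \<cdot>\<^sub>m series_mat V m L Y (rat_expand V (m, P) s))"
  using assms(2)
proof (induction s)
  case (Pol f)
  then have f: "f \<in> nc_polys_over V" by simp
  have "map_mat fps_of_poly (line_nc_eval m L P Y f) =
    fps_of_poly 1 \<cdot>\<^sub>m series_mat V m L Y (rat_expand V (m, P) (Pol f))"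
    by (simp add: series_mat_nc_expand[OF f pointsD(2)[OF pt]]) (rule eq_matI, auto)
  moreover have "represents_on_line (Pol f) (m * L) (line_point V m L P Y) 1 (line_nc_eval m L P Y f)"
    unfolding represents_on_line_def by (auto simp: nc_eval_line_point[OF f] intro!: eq_matI)
  ultimately show ?case
    by (intro exI[of _ 1] exI[of _ "line_nc_eval m L P Y f"]) simp
next
  case (Add s s')
  obtain d M d' M' where
    M: "represents_on_line s (m * L) (line_point V m L P Y) d M"
      "rat_eval (m, P) s \<noteq> None \<Longrightarrow> poly d 0 \<noteq> 0 \<and>
        map_mat fps_of_poly M = fps_of_poly d \<cdot>\<^sub>m series_mat V m L Y (rat_expand V (m, P) s)" and
    M': "represents_on_line s' (m * L) (line_point V m L P Y) d' M'"
      "rat_eval (m, P) s' \<noteq> None \<Longrightarrow> poly d' 0 \<noteq> 0 \<and>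
        map_mat fps_of_poly M' = fps_of_poly d' \<cdot>\<^sub>m series_mat V m L Y (rat_expand V (m, P) s')"
    using Add by fastforce
  have carr: "M \<in> carrier_mat (m * L) (m * L)" "M' \<in> carrier_mat (m * L) (m * L)"
    using M(1) M'(1) by (auto simp: represents_on_line_def)
  have "poly (d * d') 0 \<noteq> 0 \<and> map_mat fps_of_poly (d' \<cdot>\<^sub>m M + d \<cdot>\<^sub>m M') =
    fps_of_poly (d * d') \<cdot>\<^sub>m series_mat V m L Y (rat_expand V (m, P) (Add s s'))"
    if def: "rat_eval (m, P) (Add s s') \<noteq> None"
  proof -
    have defs: "rat_eval (m, P) s \<noteq> None" "rat_eval (m, P) s' \<noteq> None"
      using def by (auto simp: bind_eq_Some_conv)
    have "map_mat fps_of_poly (d' \<cdot>\<^sub>m M + d \<cdot>\<^sub>m M') =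
      fps_of_poly d' \<cdot>\<^sub>m map_mat fps_of_poly M + fps_of_poly d \<cdot>\<^sub>m map_mat fps_of_poly M'"
      by (rule eq_matI) (use carr in \<open>auto simp: fps_of_poly_add fps_of_poly_mult\<close>)
    also have "\<dots> = fps_of_poly (d * d') \<cdot>\<^sub>m series_mat V m L Y (rat_expand V (m, P) (Add s s'))"
      using M(2)[OF defs(1)] M'(2)[OF defs(2)]
      by (intro eq_matI) (auto simp: series_mat_add fps_of_poly_mult algebra_simps)
    finally show ?thesis
      using M(2)[OF defs(1)] M'(2)[OF defs(2)] by simp
  qed
  then show ?case
    using represents_on_line_Add[OF M(1) M'(1)] by blast
next
  case (Mul s s')
  obtain d M d' M' where
    M: "represents_on_line s (m * L) (line_point V m L P Y) d M"
      "rat_eval (m, P) s \<noteq> None \<Longrightarrow> poly d 0 \<noteq> 0 \<and>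
        map_mat fps_of_poly M = fps_of_poly d \<cdot>\<^sub>m series_mat V m L Y (rat_expand V (m, P) s)" and
    M': "represents_on_line s' (m * L) (line_point V m L P Y) d' M'"
      "rat_eval (m, P) s' \<noteq> None \<Longrightarrow> poly d' 0 \<noteq> 0 \<and>
        map_mat fps_of_poly M' = fps_of_poly d' \<cdot>\<^sub>m series_mat V m L Y (rat_expand V (m, P) s')"
    using Mul by fastforce
  have carr: "M \<in> carrier_mat (m * L) (m * L)" "M' \<in> carrier_mat (m * L) (m * L)"
    using M(1) M'(1) by (auto simp: represents_on_line_def)
  have "poly (d * d') 0 \<noteq> 0 \<and> map_mat fps_of_poly (M * M') =
    fps_of_poly (d * d') \<cdot>\<^sub>m series_mat V m L Y (rat_expand V (m, P) (Mul s s'))"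
    if def: "rat_eval (m, P) (Mul s s') \<noteq> None"
  proof -
    let ?S = "series_mat V m L Y (rat_expand V (m, P) s)"
    let ?S' = "series_mat V m L Y (rat_expand V (m, P) s')"
    have defs: "rat_eval (m, P) s \<noteq> None" "rat_eval (m, P) s' \<noteq> None"
      using def by (auto simp: bind_eq_Some_conv)
    have "map_mat fps_of_poly (M * M') = (fps_of_poly d \<cdot>\<^sub>m ?S) * (fps_of_poly d' \<cdot>\<^sub>m ?S')"
      using fps_of_poly.mat_hom_mult[OF carr] M(2)[OF defs(1)] M'(2)[OF defs(2)] by simp
    also have "\<dots> = fps_of_poly (d * d') \<cdot>\<^sub>m (?S * ?S')"
      by (rule eq_matI) (auto simp: fps_of_poly_mult)
    finally show ?thesis
      using M(2)[OF defs(1)] M'(2)[OF defs(2)] by (simp add: series_mat_mult)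
  qed
  then show ?case
    using represents_on_line_Mul[OF M(1) M'(1)] by blast
next
  case (Inv s)
  obtain d M where
    M: "represents_on_line s (m * L) (line_point V m L P Y) d M"
      "rat_eval (m, P) s \<noteq> None \<Longrightarrow> poly d 0 \<noteq> 0 \<and>
        map_mat fps_of_poly M = fps_of_poly d \<cdot>\<^sub>m series_mat V m L Y (rat_expand V (m, P) s)"
    using Inv by fastforce
  have carr: "M \<in> carrier_mat (m * L) (m * L)"
    using M(1) by (auto simp: represents_on_line_def)
  note adj = adj_mat[OF carr]
  have "poly (d * det M) 0 \<noteq> 0 \<and> map_mat fps_of_poly (d ^ 2 \<cdot>\<^sub>m adj_mat M) =
    fps_of_poly (d * det M) \<cdot>\<^sub>m series_mat V m L Y (rat_expand V (m, P) (Inv s))"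
    if def: "rat_eval (m, P) (Inv s) \<noteq> None"
  proof -
    interpret R: ring "gen_series_ring V m" by (rule ring_gen_series_ring)
    let ?S = "series_mat V m L Y (rat_expand V (m, P) s)"
    let ?T = "series_mat V m L Y (rat_expand V (m, P) (Inv s))"
    let ?F = "map_mat fps_of_poly (adj_mat M)"
    have F: "?F \<in> carrier_mat (m * L) (m * L)" using adj(1) by simp
    have "rat_eval (m, P) s \<noteq> None"
      using def by (auto simp: bind_eq_Some_conv)
    note MS = M(2)[OF this]
    have "?S * ?T = 1\<^sub>m (m * L)"
      using rat_expand_unit[OF pt _ def] Inv.prems
      by (simp add: series_mat_mult[symmetric] R.Units_r_inv series_mat_one)
    note ST = this
    then have "det ?S * det ?T = 1"
      using det_mult[of ?S "m * L" ?T] by simp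
    then have "fps_nth (det ?S) 0 \<noteq> 0"
      by (metis fps_mult_nth_0 fps_one_nth mult_zero_left zero_neq_one)
    moreover have "fps_of_poly (det M) = fps_of_poly d ^ (m * L) * det ?S"
      unfolding fps_of_poly.hom_det[symmetric] using MS by simp
    then have "poly (det M) 0 = poly d 0 ^ (m * L) * fps_nth (det ?S) 0"
      by (metis fps_mult_nth_0 fps_of_poly_nth fps_power_zeroth poly_0_coeff_0)
    ultimately have det0: "poly (det M) 0 \<noteq> 0"
      using MS by simp
    \<comment> \<open>Multiply \<open>adj M * M = det M\<close> by the series of the inverse and use \<open>M = d S\<close>.\<close>
    have "fps_of_poly (det M) \<cdot>\<^sub>m ?T = (fps_of_poly (det M) \<cdot>\<^sub>m 1\<^sub>m (m * L)) * ?T"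
      by (simp add: mult_smult_assoc_mat[OF one_carrier_mat series_mat_carrier(1)])
    also have "fps_of_poly (det M) \<cdot>\<^sub>m 1\<^sub>m (m * L) = map_mat fps_of_poly (adj_mat M * M)"
      unfolding adj(3) by (rule eq_matI) auto
    also have "\<dots> = ?F * (fps_of_poly d \<cdot>\<^sub>m ?S)"
      using fps_of_poly.mat_hom_mult[OF adj(1) carr] MS by simp
    also have "\<dots> = fps_of_poly d \<cdot>\<^sub>m (?F * ?S)"
      by (rule mult_smult_distrib[OF F series_mat_carrier(1)])
    also have "\<dots> * ?T = fps_of_poly d \<cdot>\<^sub>m (?F * ?S * ?T)"
      by (rule mult_smult_assoc_mat[of _ "m * L" "m * L"]) (use F in auto)
    also have "?F * ?S * ?T = ?F"
      unfolding assoc_mult_mat[OF F series_mat_carrier(1) series_mat_carrier(1)] ST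
      by (rule right_mult_one_mat[OF F])
    finally have "fps_of_poly (det M) \<cdot>\<^sub>m ?T = fps_of_poly d \<cdot>\<^sub>m ?F" .
    note eqM = this
    have eq: "fps_of_poly (det M) * ?T $$ (I, J) = fps_of_poly d * fps_of_poly (adj_mat M $$ (I, J))"
      if "I < m * L" "J < m * L" for I J
      using that adj(1) arg_cong[OF eqM, of "\<lambda>M. M $$ (I, J)"] by (simp del: rat_expand.simps)
    have "map_mat fps_of_poly (d ^ 2 \<cdot>\<^sub>m adj_mat M) = fps_of_poly (d * det M) \<cdot>\<^sub>m ?T"
      by (rule eq_matI)
        (use adj(1) eq in \<open>auto simp: fps_of_poly_mult power2_eq_square mult.assoc simp del: rat_expand.simps\<close>)
    then show ?thesis
      using det0 MS by simp
  qed
  then show ?case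
    using represents_on_line_Inv[OF M(1)] by blast
qed


section \<open>Lines between amplified points\<close>

lemma line_point_in_points:
  assumes "m \<ge> 1" "L \<ge> 1"
  shows "line_point V m L P Y t \<in> points V"
proof -
  have "m * L \<ge> 1" using assms by simp
  then show ?thesis
    by (auto simp: line_point_def points_def points_of_size_def)
qed

definition amplified_point :: "'x set \<Rightarrow> nat \<Rightarrow> nat \<Rightarrow> ('x \<Rightarrow> 'k::field mat) \<Rightarrow> ('x, 'k) point" where
  "amplified_point V m L P = (m * L, \<lambda>x\<in>V. amplify L (P x))"

lemma line_point_0:
  assumes "(m, P) \<in> points V"
  shows "line_point V m L P Y 0 = amplified_point V m L P"
proof -
  have "map_mat (\<lambda>p. poly p 0) (line_letter m L P Y x) = amplify L (P x)" if "x \<in> V" for x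
    using amplify_carrier[OF pointsD(2)[OF assms that], of L]
    by (intro eq_matI) (auto simp: line_letter_def)
  then show ?thesis
    by (auto simp: line_point_def amplified_point_def)
qed

lemma exists_line_between:
  assumes P: "(m, P) \<in> points V" and Q: "(q, Q) \<in> points V"
  shows "\<exists>Y. line_point V m q P Y 1 = amplified_point V q m Q"
proof -
  define Y where "Y = (\<lambda>(x, a, b) r s. amplify m (Q x) $$ (a * q + r, b * q + s) -
    amplify q (P x) $$ (a * q + r, b * q + s))"
  have "map_mat (\<lambda>p. poly p 1) (line_letter m q P Y x) = amplify m (Q x)" if "x \<in> V" for x
    using amplify_carrier[OF pointsD(2)[OF P that], of q] amplify_carrier[OF pointsD(2)[OF Q that], of m]
    by (intro eq_matI) (auto simp: line_letter_def Y_def mult.commute[of q m])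
  then have "line_point V m q P Y 1 = amplified_point V q m Q"
    by (auto simp: line_point_def amplified_point_def mult.commute)
  then show ?thesis
    by (rule exI[of _ Y])
qed

text \<open>
  The amplified point is the point at \<open>t = 0\<close> of any line, and the coefficient at \<open>t\<^sup>0\<close> of the
  expansion is the amplified constant term of the series.
\<close>

lemma rat_eval_amplified_point:
  fixes V :: "'x::finite set" and P :: "'x \<Rightarrow> 'k::field mat"
  assumes P: "(m, P) \<in> points V" and s: "polys s \<subseteq> nc_polys_over V" and B: "rat_eval (m, P) s = Some B"
  shows "rat_eval (amplified_point V m L P) s = Some (amplify L B)"
proof -
  define Y :: "'x \<times> nat \<times> nat \<Rightarrow> nat \<Rightarrow> nat \<Rightarrow> 'k" where "Y = (\<lambda>_ _ _. 0)"
  obtain d M where dM: "represents_on_line s (m * L) (line_point V m L P Y) d M"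
    "poly d 0 \<noteq> 0" "map_mat fps_of_poly M = fps_of_poly d \<cdot>\<^sub>m series_mat V m L Y (rat_expand V (m, P) s)"
    using rat_expr_on_line[OF P s, of L Y] B by auto
  have M: "M \<in> carrier_mat (m * L) (m * L)"
    using dM(1) by (simp add: represents_on_line_def)
  note at = rat_expand_at_point[OF P s B]
  have "inverse (poly d 0) \<cdot>\<^sub>m map_mat (\<lambda>p. poly p 0) M = amplify L B"
  proof (rule eq_matI)
    fix I J assume "I < dim_row (amplify L B)" "J < dim_col (amplify L B)"
    then have IJ: "I < m * L" "J < m * L"
      using amplify_carrier[OF at(1), of L] by auto
    have ij: "I div L < m" "J div L < m"
      using IJ by (auto simp: less_mult_imp_div_less)
    have "fps_of_poly (M $$ (I, J)) = fps_of_poly d * series_mat V m L Y (rat_expand V (m, P) s) $$ (I, J)"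
      using arg_cong[OF dM(3), of "\<lambda>M. M $$ (I, J)"] IJ M by simp
    then have "fps_nth (fps_of_poly (M $$ (I, J))) 0 =
      fps_nth (fps_of_poly d) 0 * fps_nth (series_mat V m L Y (rat_expand V (m, P) s) $$ (I, J)) 0"
      by simp
    also have "fps_nth (series_mat V m L Y (rat_expand V (m, P) s) $$ (I, J)) 0 = amplify L B $$ (I, J)"
      using IJ ij at(3) by (simp add: series_mat_nth amplify_index[OF at(1)])
    finally have "poly (M $$ (I, J)) 0 = poly d 0 * amplify L B $$ (I, J)"
      by (simp add: poly_0_coeff_0)
    then show "(inverse (poly d 0) \<cdot>\<^sub>m map_mat (\<lambda>p. poly p 0) M) $$ (I, J) = amplify L B $$ (I, J)"
      using IJ M dM(2) by simp
  qed (use M amplify_carrier[OF at(1), of L] in auto)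
  moreover have "rat_eval (line_point V m L P Y 0) s = Some (inverse (poly d 0) \<cdot>\<^sub>m map_mat (\<lambda>p. poly p 0) M)"
    using dM(1,2) by (auto simp: represents_on_line_def)
  ultimately show ?thesis
    by (simp add: line_point_0[OF P])
qed

lemma rat_equivD:
  assumes "(t, s) \<in> rat_equiv V" "p \<in> points V" "rat_eval p t \<noteq> None" "rat_eval p s \<noteq> None"
  shows "rat_eval p t = rat_eval p s"
proof -
  have "p \<in> expr_dom V t \<inter> expr_dom V s"
    using assms(2-4) by (simp add: expr_dom_def)
  then show ?thesis
    using assms(1) unfolding rat_equiv_def by blast
qed

text \<open>
  A line through the amplified point at which \<open>s\<close> and \<open>s'\<close> are compared and a point of the domain
  of \<open>t\<close> meets the three domains in all but finitely many points. So \<open>s\<close> and \<open>s'\<close> agree on it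
  if both agree with \<open>t\<close>, and the equivalence of expressions is transitive.
\<close>

lemma rat_expr_agree_trans:
  fixes V :: "'x::finite set" and P :: "'x \<Rightarrow> 'k::field_char_0 mat"
  assumes P: "(m, P) \<in> points V" and ts: "(t, s) \<in> rat_equiv V" and ts': "(t, s') \<in> rat_equiv V"
    and B: "rat_eval (m, P) s = Some B" "rat_eval (m, P) s' = Some B'"
  shows "B = B'"
proof -
  have over: "polys s \<subseteq> nc_polys_over V" "polys s' \<subseteq> nc_polys_over V" "polys t \<subseteq> nc_polys_over V"
    and "expr_dom V t \<noteq> {}"
    using ts ts' by (auto simp: rat_equiv_def rat_exprs_def)
  then obtain q Q C where Q: "(q, Q) \<in> points V" and C: "rat_eval (q, Q) t = Some C"
    by (auto simp: expr_dom_def)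
  obtain Y where Y: "line_point V m q P Y 1 = amplified_point V q m Q"
    using exists_line_between[OF P Q] by blast
  let ?l = "line_point V m q P Y"
  note on_line = rat_expr_on_line[OF P, where L = q and Y = Y]
  obtain d M where dM: "represents_on_line s (m * q) ?l d M"
    using on_line[OF over(1)] by blast
  obtain d' M' where dM': "represents_on_line s' (m * q) ?l d' M'"
    using on_line[OF over(2)] by blast
  obtain d\<^sub>0 M\<^sub>0 where dM\<^sub>0: "represents_on_line t (m * q) ?l d\<^sub>0 M\<^sub>0"
    using on_line[OF over(3)] by blast
  have M: "M \<in> carrier_mat (m * q) (m * q)" "M' \<in> carrier_mat (m * q) (m * q)"
    using dM dM' by (auto simp: represents_on_line_def)
  have d0: "poly d 0 \<noteq> 0" "poly d' 0 \<noteq> 0"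
    "inverse (poly d 0) \<cdot>\<^sub>m map_mat (\<lambda>p. poly p 0) M = amplify q B"
    "inverse (poly d' 0) \<cdot>\<^sub>m map_mat (\<lambda>p. poly p 0) M' = amplify q B'"
    using dM dM' rat_eval_amplified_point[OF P over(1) B(1), of q]
      rat_eval_amplified_point[OF P over(2) B(2), of q] line_point_0[OF P, of q Y]
    unfolding represents_on_line_def by (metis option.distinct(1) option.inject)+
  have "poly d\<^sub>0 1 \<noteq> 0"
    using dM\<^sub>0 rat_eval_amplified_point[OF Q over(3) C, of m] Y
    unfolding represents_on_line_def by (metis option.distinct(1))
  then have nz: "d \<noteq> 0" "d' \<noteq> 0" "d\<^sub>0 \<noteq> 0"
    using d0 by auto
  have "d' * M $$ (I, J) = d * M' $$ (I, J)" if "I < m * q" "J < m * q" for I J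
  proof -
    have "poly (d * d' * d\<^sub>0 * (d' * M $$ (I, J) - d * M' $$ (I, J))) t' = 0" for t'
    proof (cases "poly d t' = 0 \<or> poly d' t' = 0 \<or> poly d\<^sub>0 t' = 0")
      case False
      have p: "?l t' \<in> points V"
        using pointsD(1)[OF P] pointsD(1)[OF Q] by (rule line_point_in_points)
      have ev: "rat_eval (?l t') s = Some (inverse (poly d t') \<cdot>\<^sub>m map_mat (\<lambda>p. poly p t') M)"
        "rat_eval (?l t') s' = Some (inverse (poly d' t') \<cdot>\<^sub>m map_mat (\<lambda>p. poly p t') M')"
        "rat_eval (?l t') t \<noteq> None"
        using dM dM' dM\<^sub>0 False by (auto simp: represents_on_line_def)
      have "rat_eval (?l t') t = rat_eval (?l t') s" "rat_eval (?l t') t = rat_eval (?l t') s'"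
        using rat_equivD[OF ts p] rat_equivD[OF ts' p] ev by auto
      then have "inverse (poly d t') \<cdot>\<^sub>m map_mat (\<lambda>p. poly p t') M =
        inverse (poly d' t') \<cdot>\<^sub>m map_mat (\<lambda>p. poly p t') M'"
        using ev by simp
      from arg_cong[OF this, of "\<lambda>M. M $$ (I, J)"]
      have "inverse (poly d t') * poly (M $$ (I, J)) t' = inverse (poly d' t') * poly (M' $$ (I, J)) t'"
        using M that by simp
      then show ?thesis
        using False by (simp add: field_simps)
    qed auto
    then have "d * d' * d\<^sub>0 * (d' * M $$ (I, J) - d * M' $$ (I, J)) = 0"
      using poly_all_0_iff_0 by blast
    then show ?thesis
      using nz by simp
  qed
  note eq = this
  have "amplify q B = amplify q B'"
    unfolding d0(3,4)[symmetric]
  proof (rule eq_matI)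
    fix I J assume "I < dim_row (inverse (poly d' 0) \<cdot>\<^sub>m map_mat (\<lambda>p. poly p 0) M')"
      "J < dim_col (inverse (poly d' 0) \<cdot>\<^sub>m map_mat (\<lambda>p. poly p 0) M')"
    then have IJ: "I < m * q" "J < m * q" using M by auto
    have "poly d' 0 * poly (M $$ (I, J)) 0 = poly d 0 * poly (M' $$ (I, J)) 0"
      using arg_cong[OF eq[OF IJ], of "\<lambda>p. poly p 0"] by simp
    then show "(inverse (poly d 0) \<cdot>\<^sub>m map_mat (\<lambda>p. poly p 0) M) $$ (I, J) =
      (inverse (poly d' 0) \<cdot>\<^sub>m map_mat (\<lambda>p. poly p 0) M') $$ (I, J)"
      using IJ M d0(1,2) by (simp add: field_simps)
  qed (use M in auto)
  then show ?thesis
    using amplify_inj[OF rat_expand_at_point(1)[OF P over(1) B(1)]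
        rat_expand_at_point(1)[OF P over(2) B(2)], of q] pointsD(1)[OF Q] by (simp add: Suc_le_eq)
qed

lemma free_skew_fieldD:
  assumes "\<rho> \<in> free_skew_field V"
  obtains t where "\<And>s. s \<in> \<rho> \<Longrightarrow> (t, s) \<in> rat_equiv V"
proof -
  obtain t where "\<rho> = rat_equiv V `` {t}"
    using assms unfolding free_skew_field_def by (auto elim!: quotientE)
  then show thesis
    by (intro that[of t]) auto
qed

lemma free_skew_field_polys:
  assumes "\<rho> \<in> free_skew_field V" "s \<in> \<rho>"
  shows "polys s \<subseteq> nc_polys_over V"
proof -
  obtain t where "\<And>s. s \<in> \<rho> \<Longrightarrow> (t, s) \<in> rat_equiv V"
    using assms(1) by (rule free_skew_fieldD) blast
  from this[OF assms(2)] show ?thesis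
    by (simp add: rat_equiv_def rat_exprs_def)
qed

lemma rat_fun_eval_eq:
  fixes V :: "'x::finite set" and A :: "'x \<Rightarrow> 'k::field_char_0 mat"
  assumes \<rho>: "\<rho> \<in> free_skew_field V" and A: "(l, A) \<in> points V"
    and s: "s \<in> \<rho>" "rat_eval (l, A) s = Some B"
  shows "rat_fun_eval (l, A) \<rho> = B"
proof -
  obtain t where t: "\<And>s. s \<in> \<rho> \<Longrightarrow> (t, s) \<in> rat_equiv V"
    using \<rho> by (rule free_skew_fieldD) blast
  define s' where "s' = (SOME s. s \<in> \<rho> \<and> rat_eval (l, A) s \<noteq> None)"
  have "s' \<in> \<rho> \<and> rat_eval (l, A) s' \<noteq> None"
    unfolding s'_def by (rule someI[of _ s]) (use s in simp)
  then obtain B' where B': "s' \<in> \<rho>" "rat_eval (l, A) s' = Some B'"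
    by blast
  have "B' = B"
    using rat_expr_agree_trans[OF A t[OF B'(1)] t[OF s(1)] B'(2) s(2)] .
  then show ?thesis
    using B'(2) by (simp add: rat_fun_eval_def s'_def)
qed


section \<open>Substituting rational expressions into a polynomial\<close>

text \<open>
  A nonempty word has no factor besides its letters, and the coefficients are separate factors
  on the left: this keeps the dimension of the sum of the realizations small.
\<close>

fun substitute_word :: "('x \<Rightarrow> ('x, 'k::field) nc_rat_expr) \<Rightarrow> 'x list \<Rightarrow> ('x, 'k) nc_rat_expr" where
  "substitute_word e [] = Pol (Poly_Mapping.single (Word []) 1)"
| "substitute_word e [x] = e x"
| "substitute_word e (x # y # w) = Mul (e x) (substitute_word e (y # w))"

primrec substitute_words ::
    "('x \<Rightarrow> ('x, 'k::field) nc_rat_expr) \<Rightarrow> ('x, 'k) nc_poly \<Rightarrow> 'x nc_word list \<Rightarrow> ('x, 'k) nc_rat_expr" where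
  "substitute_words e f [] = Pol 0"
| "substitute_words e f (w # ws) = Add
     (Mul (Pol (Poly_Mapping.single (Word []) (Poly_Mapping.lookup f w))) (substitute_word e (letters w)))
     (substitute_words e f ws)"

lemma const_poly_over: "Poly_Mapping.single (Word []) c \<in> nc_polys_over V"
  by (auto simp: nc_polys_over_def split: if_splits)

lemma letter_poly_over: "x \<in> V \<Longrightarrow> Poly_Mapping.single (Word [x]) c \<in> nc_polys_over V"
  by (auto simp: nc_polys_over_def split: if_splits)

lemma nc_eval_carrier: "nc_eval (l, A) f \<in> carrier_mat l l"
  by (simp add: nc_eval_def)

lemma nc_eval_single:
  assumes "word_eval l A w \<in> carrier_mat l l"
  shows "nc_eval (l, A) (Poly_Mapping.single (Word w) c) = c \<cdot>\<^sub>m word_eval l A w"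
  using assms by (intro eq_matI) (auto simp: nc_eval_def)

lemma polys_substitute_words:
  assumes "\<And>x. polys (e x) \<subseteq> nc_polys_over V"
  shows "polys (substitute_words e f ws) \<subseteq> nc_polys_over V"
proof -
  have "polys (substitute_word e w) \<subseteq> nc_polys_over V" for w
    using assms by (induction w rule: induct_list012) (auto simp: const_poly_over)
  moreover have "0 \<in> nc_polys_over V"
    by (simp add: nc_polys_over_def)
  ultimately show ?thesis
    by (induction ws) (auto simp: const_poly_over)
qed

lemma rat_eval_substitute_words:
  assumes B: "\<And>x. B x \<in> carrier_mat l l" and e: "\<And>x. rat_eval (l, A) (e x) = Some (B x)"
    and ws: "distinct ws" "set ws = Poly_Mapping.keys f"
  shows "rat_eval (l, A) (substitute_words e f ws) = Some (nc_eval (l, B) f)"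
proof -
  have word: "rat_eval (l, A) (substitute_word e w) = Some (word_eval l B w)" for w
    by (induction w rule: induct_list012)
      (simp_all add: nc_eval_single e right_mult_one_mat[OF B], intro eq_matI, auto)
  have W: "word_eval l B w \<in> carrier_mat l l" for w
    using B by (intro word_eval_carrier)
  have "rat_eval (l, A) (substitute_words e f vs) = Some (mat l l (\<lambda>ij. \<Sum>w\<leftarrow>vs.
      Poly_Mapping.lookup f w * word_eval l B (letters w) $$ ij))" for vs
  proof (induction vs)
    case Nil
    then show ?case by (auto simp: nc_eval_def)
  next
    case (Cons w vs)
    have "c \<cdot>\<^sub>m 1\<^sub>m l * word_eval l B (letters w) = c \<cdot>\<^sub>m word_eval l B (letters w)" for c
      unfolding mult_smult_assoc_mat[OF one_carrier_mat W] left_mult_one_mat[OF W] ..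
    then show ?case
      using Cons W[of "letters w"] by (auto simp: word nc_eval_single intro!: eq_matI)
  qed
  then show ?thesis
    using ws by (simp add: nc_eval_def sum_list_distinct_conv_sum_set)
qed

lemma nc_expand_const_poly:
  "nc_expand V (m, P) (Poly_Mapping.single (Word []) c) =
    (\<lambda>i \<omega> j. if i < m \<and> \<omega> = [] \<and> i = j then c else 0)"
  unfolding nc_expand_eq_sum[OF const_poly_over]
  by (intro ext) (auto simp: word_expand_simps gen_series_ring_simps)

lemma shift_dim_le_letter_poly:
  fixes V :: "'x set" and P :: "'x \<Rightarrow> 'k::field mat"
  assumes x: "x \<in> V" and P: "P x \<in> carrier_mat m m"
  shows "shift_dim_le m (nc_expand V (m, P) (Poly_Mapping.single (Word [x]) 1)) (2 * m)"
proof -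
  interpret ring "gen_series_ring V m" by (rule ring_gen_series_ring)
  have "word_expand V m P [x] = letter_series m x \<oplus>\<^bsub>gen_series_ring V m\<^esub> const_series m (P x)"
    unfolding word_expand_simps
    by (intro r_one a_closed letter_series_carrier[OF x] const_series_carrier)
  then have "nc_expand V (m, P) (Poly_Mapping.single (Word [x]) 1) =
    (\<lambda>i \<omega> j. letter_series m x i \<omega> j + const_series m (P x) i \<omega> j)"
    unfolding nc_expand_eq_sum[OF letter_poly_over[OF x]]
    by (intro ext) (auto simp: gen_series_ring_simps)
  then show ?thesis
    using shift_dim_le_letter[OF P] by simp
qed

lemma shift_dim_le_substitute_words:
  fixes V :: "'x set" and P :: "'x \<Rightarrow> 'k::field mat"
  assumes e: "\<And>x. shift_dim_le m (rat_expand V (m, P) (e x)) D" and D: "m \<le> D"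
    and u: "u \<ge> 1" "\<And>w. w \<in> set ws \<Longrightarrow> length (letters w) \<le> u"
  shows "shift_dim_le m (rat_expand V (m, P) (substitute_words e f ws)) (length ws * (u * D))"
proof -
  have one: "shift_dim_le m (rat_expand V (m, P) (substitute_word e [])) m"
    by (simp add: nc_expand_const_poly) (rule shift_dim_le_const, auto split: if_splits)
  have ne: "w \<noteq> [] \<Longrightarrow> shift_dim_le m (rat_expand V (m, P) (substitute_word e w)) (length w * D)" for w
  proof (induction w rule: list_nonempty_induct)
    case (single x)
    then show ?case using e by simp
  next
    case (cons x w)
    then show ?case
      using shift_dim_le_mult[OF e[of x] cons.IH, where V = V] by (cases w) simp_all
  qed
  have word: "shift_dim_le m (rat_expand V (m, P) (substitute_word e w)) (u * D)" if "length w \<le> u" for w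
  proof (cases "w = []")
    case True
    have "m \<le> u * D"
      using D u(1) by (metis le_trans mult_le_mono1 nat_mult_1)
    then show ?thesis
      using True one shift_dim_le_mono by blast
  next
    case False
    have "length w * D \<le> u * D" using that by simp
    then show ?thesis
      using ne[OF False] shift_dim_le_mono by blast
  qed
  show ?thesis
    using u(2)
  proof (induction ws)
    case Nil
    have "rat_expand V (m, P) (Pol 0) = (\<lambda>i \<omega> j. 0)"
      using nc_expand_eq_sum[of 0 V m P] by (simp add: nc_polys_over_def)
    then show ?case
      by (simp add: shift_dim_le_zero)
  next
    case (Cons w ws)
    let ?c = "nc_expand V (m, P) (Poly_Mapping.single (Word []) (Poly_Mapping.lookup f w))"
    have "shift_dim_le m (?c \<otimes>\<^bsub>gen_series_ring V m\<^esub> rat_expand V (m, P) (substitute_word e (letters w))) (u * D)"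
      using word Cons.prems by (intro shift_dim_le_left_const) (auto simp: nc_expand_const_poly)
    moreover have "shift_dim_le m (rat_expand V (m, P) (substitute_words e f ws)) (length ws * (u * D))"
      using Cons by simp
    ultimately show ?case
      using shift_dim_le_add by (fastforce simp: gen_series_ring_simps)
  qed
qed


section \<open>Vanishing on the graph of the resolvent\<close>

lemma resolvent_dom_exprs:
  assumes "(m, P) \<in> resolvent_dom V r"
  obtains e where "\<And>x. x \<in> V \<Longrightarrow> e x = Pol (Poly_Mapping.single (Word [x]) 1)"
    and "\<And>x. x \<notin> V \<Longrightarrow> e x \<in> r x" and "\<And>x. rat_eval (m, P) (e x) \<noteq> None"
proof -
  have "\<forall>x\<in>- V. (m, P) \<in> rat_fun_dom V (r x)"
    using assms by (simp add: resolvent_dom_def)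
  then have "\<exists>s. s \<in> r x \<and> rat_eval (m, P) s \<noteq> None" if "x \<notin> V" for x
    using that unfolding rat_fun_dom_def expr_dom_def by blast
  then obtain s where "\<And>x. x \<notin> V \<Longrightarrow> s x \<in> r x \<and> rat_eval (m, P) (s x) \<noteq> None"
    by metis
  then show thesis
    by (intro that[of "\<lambda>x. if x \<in> V then Pol (Poly_Mapping.single (Word [x]) 1) else s x"]) auto
qed

lemma smult_one_mat: "(1 :: 'a :: monoid_mult) \<cdot>\<^sub>m A = A"
  by (rule eq_matI) auto

lemma exprs_polys:
  assumes "\<And>x. x \<notin> V \<Longrightarrow> r x \<in> free_skew_field V"
    and "\<And>x. x \<in> V \<Longrightarrow> e x = Pol (Poly_Mapping.single (Word [x]) 1)" "\<And>x. x \<notin> V \<Longrightarrow> e x \<in> r x"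
  shows "polys (e x) \<subseteq> nc_polys_over V"
proof (cases "x \<in> V")
  case True
  then show ?thesis
    using assms(2) letter_poly_over by fastforce
next
  case False
  show ?thesis
    by (rule free_skew_field_polys[OF assms(1)[OF False] assms(3)[OF False]])
qed

text \<open>
  The tuple of expressions \<open>e\<close> has at a point the values that make up the point of the graph
  above it: the matrices of the letters in \<open>V\<close> and the values of the resolvent.
\<close>

lemma resolvent_graph_point:
  fixes V :: "'x::finite set" and A :: "'x \<Rightarrow> 'k::field_char_0 mat"
  assumes r: "\<And>x. x \<notin> V \<Longrightarrow> r x \<in> free_skew_field V"
    and e: "\<And>x. x \<in> V \<Longrightarrow> e x = Pol (Poly_Mapping.single (Word [x]) 1)" "\<And>x. x \<notin> V \<Longrightarrow> e x \<in> r x"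
    and p: "(l, A) \<in> points V" and def: "\<And>x. x \<notin> V \<Longrightarrow> rat_eval (l, A) (e x) \<noteq> None"
    and B_def: "B = (\<lambda>x. if x \<in> V then A x else rat_fun_eval (l, A) (r x))"
  shows "(l, B) \<in> resolvent_graph V r" and "B x \<in> carrier_mat l l"
    and "rat_eval (l, A) (e x) = Some (B x)"
proof -
  have dom: "(l, A) \<in> resolvent_dom V r"
    using p e(2) def by (fastforce simp: resolvent_dom_def rat_fun_dom_def expr_dom_def)
  then show "(l, B) \<in> resolvent_graph V r"
    unfolding resolvent_graph_def B_def by force
  have "B x \<in> carrier_mat l l \<and> rat_eval (l, A) (e x) = Some (B x)"
  proof (cases "x \<in> V")
    case True
    then have "A x \<in> carrier_mat l l"
      using pointsD(2)[OF p] by simp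
    then show ?thesis
      using True e(1) smult_one_mat[of "A x"] by (simp add: B_def nc_eval_single)
  next
    case False
    then obtain C where C: "rat_eval (l, A) (e x) = Some C"
      using def by blast
    then have "rat_fun_eval (l, A) (r x) = C"
      using rat_fun_eval_eq[OF r p e(2)] False by blast
    then show ?thesis
      using False C rat_expand_at_point(1)[OF p free_skew_field_polys[OF r e(2)] C] by (simp add: B_def)
  qed
  then show "B x \<in> carrier_mat l l" "rat_eval (l, A) (e x) = Some (B x)"
    by auto
qed

text \<open>
  If a polynomial vanishes on the part of the graph above a line, then the numerator of the
  substituted expression is zero, hence so is its expansion at the amplified point.
\<close>

lemma substituted_series_zero_on_line:
  fixes V :: "'x::finite set" and P :: "'x \<Rightarrow> 'k::field_char_0 mat"
  assumes r: "\<And>x. x \<notin> V \<Longrightarrow> r x \<in> free_skew_field V"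
    and e: "\<And>x. x \<in> V \<Longrightarrow> e x = Pol (Poly_Mapping.single (Word [x]) 1)" "\<And>x. x \<notin> V \<Longrightarrow> e x \<in> r x"
    and P: "(m, P) \<in> points V" and def: "\<And>x. rat_eval (m, P) (e x) \<noteq> None"
    and ws: "distinct ws" "set ws = Poly_Mapping.keys f"
    and L: "L \<ge> 1"
    and vanish: "\<And>B. (m * L, B) \<in> resolvent_graph V r \<Longrightarrow> nc_eval (m * L, B) f = 0\<^sub>m (m * L) (m * L)"
  shows "series_mat V m L Y (rat_expand V (m, P) (substitute_words e f ws)) = 0\<^sub>m (m * L) (m * L)"
proof -
  let ?F = "substitute_words e f ws"
  let ?l = "line_point V m L P Y"
  have over: "polys (e x) \<subseteq> nc_polys_over V" for x
    by (rule exprs_polys[OF r e])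
  note overF = polys_substitute_words[of e, OF over]
  define B where "B x = the (rat_eval (m, P) (e x))" for x
  have B: "rat_eval (m, P) (e x) = Some (B x)" for x
    using def[of x] by (auto simp: B_def)
  have defF: "rat_eval (m, P) ?F \<noteq> None"
    using rat_eval_substitute_words[OF rat_expand_at_point(1)[OF P over B] B ws] by simp
  obtain d M where F: "represents_on_line ?F (m * L) ?l d M" "poly d 0 \<noteq> 0"
    "map_mat fps_of_poly M = fps_of_poly d \<cdot>\<^sub>m series_mat V m L Y (rat_expand V (m, P) ?F)"
    using rat_expr_on_line[OF P overF, where L = L and Y = Y] defF by blast
  have M: "M \<in> carrier_mat (m * L) (m * L)"
    using F(1) by (simp add: represents_on_line_def)
  have "\<forall>x. \<exists>d M. represents_on_line (e x) (m * L) ?l d M \<and> poly d 0 \<noteq> 0"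
    using rat_expr_on_line[OF P over, where L = L and Y = Y] def by blast
  then obtain de Me where e_line: "\<And>x. represents_on_line (e x) (m * L) ?l (de x) (Me x)"
    "\<And>x. poly (de x) 0 \<noteq> 0"
    by metis
  \<comment> \<open>Where \<open>D\<close> is not zero, all the \<open>e x\<close> are defined, also those for letters that do not occur
    in \<open>f\<close>; only then does the point lie under a point of the graph.\<close>
  define D where "D = d * (\<Prod>x\<in>UNIV. de x)"
  have D: "D \<noteq> 0"
  proof -
    have "poly D 0 \<noteq> 0"
      using F(2) e_line(2) by (simp add: D_def poly_prod)
    then show ?thesis by auto
  qed
  have M0: "M $$ (I, J) = 0" if IJ: "I < m * L" "J < m * L" for I J
  proof -
    have "poly (D * M $$ (I, J)) t = 0" for t
    proof (cases "poly D t = 0")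
      case False
      then have nz: "poly d t \<noteq> 0" "\<And>x. poly (de x) t \<noteq> 0"
        by (auto simp: D_def poly_prod)
      obtain A where A: "?l t = (m * L, A)"
        by (simp add: line_point_def)
      have p: "(m * L, A) \<in> points V"
        using line_point_in_points[OF pointsD(1)[OF P] L, of V P Y t] A by simp
      have defs: "rat_eval (m * L, A) (e x) \<noteq> None" for x
        using represents_on_lineD[OF e_line(1) nz(2), of x] A by simp
      note graph = resolvent_graph_point[OF r e p defs refl]
      have "rat_eval (m * L, A) ?F = Some (0\<^sub>m (m * L) (m * L))"
        using rat_eval_substitute_words[OF graph(2,3) ws] vanish[OF graph(1)] by simp
      moreover have "rat_eval (m * L, A) ?F = Some (inverse (poly d t) \<cdot>\<^sub>m map_mat (\<lambda>p. poly p t) M)"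
        using represents_on_lineD[OF F(1) nz(1)] A by simp
      ultimately have "inverse (poly d t) \<cdot>\<^sub>m map_mat (\<lambda>p. poly p t) M = 0\<^sub>m (m * L) (m * L)"
        by simp
      from arg_cong[OF this, of "\<lambda>M. M $$ (I, J)"] show ?thesis
        using IJ M nz(1) by simp
    qed simp
    then have "D * M $$ (I, J) = 0"
      using poly_all_0_iff_0 by blast
    then show ?thesis
      using D by simp
  qed
  show ?thesis
  proof (rule eq_matI)
    fix I J assume "I < dim_row (0\<^sub>m (m * L) (m * L) :: 'k fps mat)" "J < dim_col (0\<^sub>m (m * L) (m * L) :: 'k fps mat)"
    then have IJ: "I < m * L" "J < m * L" by auto
    have "fps_of_poly d * series_mat V m L Y (rat_expand V (m, P) ?F) $$ (I, J) = 0"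
      using arg_cong[OF F(3), of "\<lambda>M. M $$ (I, J)"] M0[OF IJ] IJ M by simp
    moreover have "fps_of_poly d \<noteq> 0"
      using F(2) by auto
    ultimately show "series_mat V m L Y (rat_expand V (m, P) ?F) $$ (I, J) =
      0\<^sub>m (m * L) (m * L) $$ (I, J)"
      using IJ by simp
  qed auto
qed

text \<open>
  Conversely, let the expansion at \<open>P\<close> be zero. Then the substituted expression is zero on the
  line from the amplified \<open>P\<close> to any amplified point \<open>Q\<close> of the domain of the resolvent, and
  so is the one that is built from expressions defined at \<open>Q\<close>, as both agree at almost all
  points of the line.
\<close>

lemma vanishes_on_graph_if_series_zero:
  fixes V :: "'x::finite set" and P Q :: "'x \<Rightarrow> 'k::field_char_0 mat"
  assumes r: "\<And>x. x \<notin> V \<Longrightarrow> r x \<in> free_skew_field V"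
    and e: "\<And>x. x \<in> V \<Longrightarrow> e x = Pol (Poly_Mapping.single (Word [x]) 1)" "\<And>x. x \<notin> V \<Longrightarrow> e x \<in> r x"
    and P: "(m, P) \<in> points V" and def: "\<And>x. rat_eval (m, P) (e x) \<noteq> None"
    and ws: "distinct ws" "set ws = Poly_Mapping.keys f"
    and zero: "rat_expand V (m, P) (substitute_words e f ws) = (\<lambda>i \<omega> j. 0)"
    and Q: "(q, C) \<in> resolvent_graph V r"
  shows "nc_eval (q, C) f = 0\<^sub>m q q"
proof -
  obtain Q where Qdom: "(q, Q) \<in> resolvent_dom V r"
    and C: "C = (\<lambda>x. if x \<in> V then Q x else rat_fun_eval (q, Q) (r x))"
    using Q unfolding resolvent_graph_def by auto
  have Q: "(q, Q) \<in> points V"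
    using Qdom by (simp add: resolvent_dom_def)
  obtain e' where e': "\<And>x. x \<in> V \<Longrightarrow> e' x = Pol (Poly_Mapping.single (Word [x]) 1)"
    "\<And>x. x \<notin> V \<Longrightarrow> e' x \<in> r x" "\<And>x. rat_eval (q, Q) (e' x) \<noteq> None"
    using Qdom by (rule resolvent_dom_exprs) blast
  note graphQ = resolvent_graph_point[OF r e'(1,2) Q e'(3) C]
  obtain Y where Y: "line_point V m q P Y 1 = amplified_point V q m Q"
    using exists_line_between[OF P Q] by blast
  let ?F = "substitute_words e f ws" and ?F' = "substitute_words e' f ws"
  let ?l = "line_point V m q P Y"
  have over: "polys (e x) \<subseteq> nc_polys_over V" "polys (e' x) \<subseteq> nc_polys_over V" for x
    using exprs_polys[OF r e] exprs_polys[OF r e'(1,2)] by simp_all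
  note overF = polys_substitute_words[of e, OF over(1)] polys_substitute_words[of e', OF over(2)]
  have F'Q: "rat_eval (q, Q) ?F' = Some (nc_eval (q, C) f)"
    by (rule rat_eval_substitute_words[OF graphQ(2,3) ws])
  note on_line = rat_expr_on_line[OF P, where L = q and Y = Y]
  define B where "B x = the (rat_eval (m, P) (e x))" for x
  have B: "rat_eval (m, P) (e x) = Some (B x)" for x
    using def[of x] by (auto simp: B_def)
  have defF: "rat_eval (m, P) ?F \<noteq> None"
    using rat_eval_substitute_words[OF rat_expand_at_point(1)[OF P over(1) B] B ws] by simp
  obtain d M where F: "represents_on_line ?F (m * q) ?l d M" "poly d 0 \<noteq> 0"
    "map_mat fps_of_poly M = fps_of_poly d \<cdot>\<^sub>m series_mat V m q Y (rat_expand V (m, P) ?F)"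
    using on_line[OF overF(1)] defF by blast
  obtain d' M' where F': "represents_on_line ?F' (m * q) ?l d' M'"
    using on_line[OF overF(2)] by blast
  have M: "M \<in> carrier_mat (m * q) (m * q)" "M' \<in> carrier_mat (m * q) (m * q)"
    using F(1) F' by (auto simp: represents_on_line_def)
  have M0: "M $$ (I, J) = 0" if "I < m * q" "J < m * q" for I J
    using arg_cong[OF F(3), of "\<lambda>M. M $$ (I, J)"] that M by (simp add: zero series_mat_zero)
  have "\<forall>x. \<exists>d M. represents_on_line (e x) (m * q) ?l d M \<and> poly d 0 \<noteq> 0"
    using on_line[OF over(1)] def by blast
  then obtain de Me where e_line: "\<And>x. represents_on_line (e x) (m * q) ?l (de x) (Me x)"
    "\<And>x. poly (de x) 0 \<noteq> 0"
    by metis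
  have "\<exists>d M. represents_on_line (e' x) (m * q) ?l d M \<and> poly d 1 \<noteq> 0" for x
  proof -
    obtain d M where dM: "represents_on_line (e' x) (m * q) ?l d M"
      using on_line[OF over(2)] by blast
    have "rat_eval (?l 1) (e' x) \<noteq> None"
      using rat_eval_amplified_point[OF Q over(2) graphQ(3), of m] Y by simp
    then have "poly d 1 \<noteq> 0"
      using dM by (auto simp: represents_on_line_def)
    then show ?thesis using dM by blast
  qed
  then obtain de' Me' where e'_line: "\<And>x. represents_on_line (e' x) (m * q) ?l (de' x) (Me' x)"
    "\<And>x. poly (de' x) 1 \<noteq> 0"
    by metis
  have F'1: "rat_eval (?l 1) ?F' = Some (amplify m (nc_eval (q, C) f))"
    using rat_eval_amplified_point[OF Q overF(2) F'Q, of m] Y by simp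
  then have d'1: "poly d' 1 \<noteq> 0"
    and val1: "inverse (poly d' 1) \<cdot>\<^sub>m map_mat (\<lambda>p. poly p 1) M' = amplify m (nc_eval (q, C) f)"
    using F' unfolding represents_on_line_def by (metis option.distinct(1) option.inject)+
  \<comment> \<open>Where \<open>D\<close> is not zero, \<open>e\<close> and \<open>e'\<close> are both defined and hence agree.\<close>
  define D where "D = d * d' * (\<Prod>x\<in>UNIV. de x) * (\<Prod>x\<in>UNIV. de' x)"
  have "d \<noteq> 0" "d' \<noteq> 0" "de x \<noteq> 0" "de' x \<noteq> 0" for x
    using F(2) d'1 e_line(2)[of x] e'_line(2)[of x] by auto
  then have D: "D \<noteq> 0"
    by (simp add: D_def)
  have M'0: "M' $$ (I, J) = 0" if IJ: "I < m * q" "J < m * q" for I J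
  proof -
    have "poly (D * M' $$ (I, J)) t = 0" for t
    proof (cases "poly D t = 0")
      case False
      then have nz: "poly d t \<noteq> 0" "poly d' t \<noteq> 0" "\<And>x. poly (de x) t \<noteq> 0" "\<And>x. poly (de' x) t \<noteq> 0"
        by (auto simp: D_def poly_prod)
      obtain A where A: "?l t = (m * q, A)"
        by (simp add: line_point_def)
      have p: "(m * q, A) \<in> points V"
        using line_point_in_points[OF pointsD(1)[OF P] pointsD(1)[OF Q], of V P Y t] A by simp
      have defs: "rat_eval (m * q, A) (e x) \<noteq> None" "rat_eval (m * q, A) (e' x) \<noteq> None" for x
        using represents_on_lineD[OF e_line(1) nz(3), of x]
          represents_on_lineD[OF e'_line(1) nz(4), of x] A by simp_all
      note graph = resolvent_graph_point[OF r e p defs(1) refl]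
        and graph' = resolvent_graph_point[OF r e'(1,2) p defs(2) refl]
      have "rat_eval (m * q, A) ?F = rat_eval (m * q, A) ?F'"
        using rat_eval_substitute_words[OF graph(2,3) ws] rat_eval_substitute_words[OF graph'(2,3) ws]
        by simp
      moreover have "rat_eval (m * q, A) ?F = Some (inverse (poly d t) \<cdot>\<^sub>m map_mat (\<lambda>p. poly p t) M)"
        "rat_eval (m * q, A) ?F' = Some (inverse (poly d' t) \<cdot>\<^sub>m map_mat (\<lambda>p. poly p t) M')"
        using represents_on_lineD[OF F(1) nz(1)] represents_on_lineD[OF F' nz(2)] A by simp_all
      ultimately have "inverse (poly d t) \<cdot>\<^sub>m map_mat (\<lambda>p. poly p t) M =
        inverse (poly d' t) \<cdot>\<^sub>m map_mat (\<lambda>p. poly p t) M'"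
        by simp
      from arg_cong[OF this, of "\<lambda>M. M $$ (I, J)"] show ?thesis
        using IJ M nz(1,2) M0[OF IJ] by simp
    qed simp
    then have "D * M' $$ (I, J) = 0"
      using poly_all_0_iff_0 by blast
    then show ?thesis
      using D by simp
  qed
  have "amplify m (nc_eval (q, C) f) = amplify m (0\<^sub>m q q)"
    unfolding val1[symmetric]
    by (rule eq_matI)
      (use M M'0 in \<open>auto simp: amplify_def less_mult_imp_div_less mult.commute[of q m]\<close>)
  then show ?thesis
    using amplify_inj[OF nc_eval_carrier zero_carrier_mat, of m] pointsD(1)[OF P] by (simp add: Suc_le_eq)
qed

theorem theorem3p9:
  fixes V :: "'x::finite set"
    and r :: "'x \<Rightarrow> ('x, 'k::field_char_0) nc_rat_expr set"
    and I :: "('x, 'k) nc_poly set"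
    and P :: "'x \<Rightarrow> 'k mat"
    and f :: "('x, 'k) nc_poly"
    and m n u v N :: nat
  assumes "ideal I class_ring"
    and "grr_with_resolvent V r I"
    and "(m, P) \<in> resolvent_dom V r"
    and "\<forall>j\<in>- V. \<exists>s\<in>r j. \<exists>d\<le>n. has_realization V (m, P) s d"
    and "nc_degree f = u" and "u \<ge> 1"
    and "nc_num_terms f = v"
    and "N = m * nat \<lceil>real (m * u * v * max n 2) / 2\<rceil>"
    and "vanishes_on f (zero_locus I \<inter> points_of_size N UNIV)"
  shows "vanishes_on f (zero_locus I)"
proof -
  have r: "r x \<in> free_skew_field V" if "x \<notin> V" for x
    using assms(2) that by (auto simp: grr_with_resolvent_def)
  have graph: "resolvent_graph V r \<subseteq> zero_locus I"
    and to_locus: "vanishes_on f (resolvent_graph V r) \<Longrightarrow> vanishes_on f (zero_locus I)"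
    using assms(2) by (auto simp: grr_with_resolvent_def)
  have P: "(m, P) \<in> points V"
    using assms(3) by (simp add: resolvent_dom_def)
  define H where "H = v * (u * (m * max n 2))"
  define L where "L = nat \<lceil>real (m * u * v * max n 2) / 2\<rceil>"
  have N: "N = m * L"
    using assms(8) by (simp add: L_def)
  have HL: "H \<le> 2 * L"
  proof -
    have "real H / 2 \<le> real L"
      unfolding L_def H_def by (simp add: mult_ac real_nat_ceiling_ge)
    then show ?thesis by linarith
  qed
  obtain ws where ws: "distinct ws" "set ws = Poly_Mapping.keys f"
    using finite_distinct_list[OF finite_keys, of f] by blast
  have len: "length ws = v"
    using assms(7) ws by (simp add: nc_num_terms_def distinct_card[symmetric])
  have deg: "length (letters w) \<le> u" if "w \<in> set ws" for w
    using assms(5) that ws(2) unfolding nc_degree_def by (auto intro!: Max_ge)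
  obtain s where s: "\<And>x. x \<notin> V \<Longrightarrow> s x \<in> r x \<and> (\<exists>d\<le>n. has_realization V (m, P) (s x) d)"
    using assms(4) by (metis ComplI)
  define e where "e x = (if x \<in> V then Pol (Poly_Mapping.single (Word [x]) 1) else s x)" for x
  have e: "\<And>x. x \<in> V \<Longrightarrow> e x = Pol (Poly_Mapping.single (Word [x]) 1)" "\<And>x. x \<notin> V \<Longrightarrow> e x \<in> r x"
    using s by (auto simp: e_def)
  have def: "rat_eval (m, P) (e x) \<noteq> None" for x
    using s[of x] by (auto simp: e_def has_realization_def expr_dom_def)
  let ?F = "substitute_words e f ws"
  let ?S = "rat_expand V (m, P) ?F"
  have over: "polys (e x) \<subseteq> nc_polys_over V" for x
    by (rule exprs_polys[OF r e])
  have dims: "shift_dim_le m (rat_expand V (m, P) (e x)) (m * max n 2)" for x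
  proof (cases "x \<in> V")
    case True
    have "2 * m \<le> m * max n 2"
      by simp
    then show ?thesis
      using shift_dim_le_letter_poly[where P = P and m = m, OF True pointsD(2)[OF P True]] shift_dim_le_mono e(1)[OF True]
      by fastforce
  next
    case False
    then obtain d where d: "d \<le> n" "has_realization V (m, P) (e x) d"
      using s by (auto simp: e_def)
    then obtain c A b where "linear_representation V m d c A b"
      "represents V m d c A b (rat_expand V (m, P) (e x))"
      by (auto simp: has_realization_def)
    moreover obtain B where "rat_eval (m, P) (e x) = Some B"
      using def by blast
    then have "rat_expand V (m, P) (e x) \<in> carrier (gen_series_ring V m)"
      by (rule rat_expand_at_point(2)[OF P over])
    ultimately have "shift_dim_le m (rat_expand V (m, P) (e x)) (d * m)"
      by (rule shift_dim_le_realization)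
    moreover have "d * m \<le> m * max n 2"
      using d(1) by (simp add: mult.commute[of d m] le_max_iff_disj)
    ultimately show ?thesis
      by (rule shift_dim_le_mono)
  qed
  have dimS: "shift_dim_le m ?S H"
    unfolding H_def len[symmetric]
    by (rule shift_dim_le_substitute_words[OF dims _ assms(6) deg])
      (simp_all add: le_max_iff_disj)
  have carrier: "?S \<in> carrier (gen_series_ring V m)"
  proof -
    define B where "B x = the (rat_eval (m, P) (e x))" for x
    have B: "rat_eval (m, P) (e x) = Some (B x)" for x
      using def[of x] by (auto simp: B_def)
    show ?thesis
      by (rule rat_expand_at_point(2)[OF P polys_substitute_words[of e, OF over]
            rat_eval_substitute_words[OF rat_expand_at_point(1)[OF P over B] B ws]])
  qed
  have short: "?S i \<omega> j = 0" if i: "i < m" and \<omega>: "length \<omega> < H" for i \<omega> j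
  proof (rule ccontr)
    assume nz: "?S i \<omega> j \<noteq> 0"
    then have j: "j < m" and \<omega>_over: "\<omega> \<in> words_over (V \<times> {..<m} \<times> {..<m}) (length \<omega>)"
      using carrier by (auto simp: mem_gen_series_ring words_over_def)
    have h: "length \<omega> < 2 * L"
      using \<omega> HL by simp
    then have L: "L \<ge> 1"
      by simp
    have vanish: "nc_eval (m * L, B) f = 0\<^sub>m (m * L) (m * L)" if "(m * L, B) \<in> resolvent_graph V r" for B
    proof -
      have B: "(m * L, B) \<in> zero_locus I"
        using that graph by blast
      then have "(m * L, B) \<in> points_of_size (m * L) UNIV"
        by (auto simp: zero_locus_def points_def points_of_size_def)
      then show ?thesis
        using assms(9) B N by (auto simp: vanishes_on_def)
    qed
    have "(\<Sum>\<omega>'\<in>words_over (V \<times> {..<m} \<times> {..<m}) (length \<omega>). ?S i \<omega>' j * path_prod L Y \<omega>' p q) = 0"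
      if "p < L" "q < L" for Y p q
    proof -
      have idx: "i * L + p < m * L" "j * L + q < m * L"
        using block_index_less i j that by auto
      have "series_mat V m L Y ?S $$ (i * L + p, j * L + q) = 0"
        using substituted_series_zero_on_line[OF r e P def ws L vanish, of Y] idx by simp
      then have "fps_nth (series_mat V m L Y ?S $$ (i * L + p, j * L + q)) (length \<omega>) = 0"
        by simp
      then show ?thesis
        unfolding series_mat_nth[OF idx] using that by simp
    qed
    then have "?S i \<omega> j = 0"
      by (intro homogeneous_zero_if_vanishing_on_matrices[OF _ h _ \<omega>_over, of "\<lambda>\<omega>. ?S i \<omega> j"]) auto
    then show False
      using nz by simp
  qed
  have "?S i \<omega> j = 0" for i \<omega> j
  proof (cases "i < m")
    case True
    then show ?thesis
      using zero_if_zero_on_short_words[OF dimS short] by blast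
  next
    case False
    then show ?thesis
      using carrier by (auto simp: mem_gen_series_ring)
  qed
  then have "?S = (\<lambda>i \<omega> j. 0)"
    by (intro ext)
  then have "vanishes_on f (resolvent_graph V r)"
    using vanishes_on_graph_if_series_zero[OF r e P def ws] by (auto simp: vanishes_on_def)
  then show ?thesis
    by (rule to_locus)
qed

end
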